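(* Let $0\le\alpha<2$ and let $u:\mathbb{R}^n\to\mathbb{R}^m$ be a minimizer of $J(u)=\int\left(\tfrac12|\nabla u|^2+W(u)\right)dx$ with $|u(x)|<M$, where $W$ satisfies hypothesis (H1) (see context) if $0<\alpha<2$, and $W(u)=\chi_{A^c}(u)$ if $\alpha=0$. Then there exists a constant $C=C(M)$ such that $$|u(x)-u(y)|\le C|x-y|\ln\left(|x-y|^{-1}\right)\quad\text{for all } x,y \text{ with } |x-y|\le\tfrac12 .$$ In particular, $u\in C^\beta(\mathbb{R}^n;\mathbb{R}^m)$ for all $\beta\in(0,1)$.
   Context: $A=\{a_1,\dots,a_N\}\subset\mathbb{R}^m$, $N\ge2$, is a set of distinct points, $A^c=\mathbb{R}^m\setminus A$, $\chi_{A^c}$ its characteristic function. The right-hand side of the estimate is read as $0$ when $x=y$. Hypothesis (H1) (for $0<\alpha<2$): $W\in C(\mathbb{R}^m;[0,+\infty))$ with $\{W=0\}=A$. There are constants $\rho_0>0$, $C^*>0$ independent of $\alpha$ such that for every $a\in A$, $W$ is differentiable in a deleted neighborhood of $a$ and $\frac{d}{d\rho}W(a+\rho\xi)\ge\alpha C^*\rho^{\alpha-1}$ for all $\rho\in(0,\rho_0]$ and all $\xi\in\mathbb{R}^m$ with $|\xi|=1$. Standing assumption: $\liminf_{|z|\to\infty}W(z)>0$. Minimizer: a map $u\in W^{1,2}_{loc}(\mathbb{R}^n,\mathbb{R}^m)\cap L^\infty(\mathbb{R}^n;\mathbb{R}^m)$ such that $J_\Omega(u+v)\ge J_\Omega(u)$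 for every $v\in W^{1,2}_0(\Omega,\mathbb{R}^m)\cap L^\infty(\Omega;\mathbb{R}^m)$ and every open bounded Lipschitz set $\Omega\subset\mathbb{R}^n$, where $J_\Omega$ is the integral over $\Omega$. *)

theory Defs
  imports "HOL-Analysis.Analysis"
begin

definition partial :: "'n \<Rightarrow> (real^'n::finite \<Rightarrow> real) \<Rightarrow> real^'n \<Rightarrow> real" where
  "partial j f x = frechet_derivative f (at x) (axis j 1)"

primrec C_k :: "nat \<Rightarrow> (real^'n::finite \<Rightarrow> real) \<Rightarrow> bool" where
  "C_k 0 f \<longleftrightarrow> continuous_on UNIV f"
| "C_k (Suc k) f \<longleftrightarrow> (\<forall>x. f differentiable (at x)) \<and> (\<forall>j. C_k k (partial j f))"

definition test_functions :: "(real^'n::finite) set \<Rightarrow> (real^'n \<Rightarrow> real) set" where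
  "test_functions \<Omega> = {\<phi>. (\<forall>k. C_k k \<phi>) \<and> compact (closure {x. \<phi> x \<noteq> 0})
      \<and> closure {x. \<phi> x \<noteq> 0} \<subseteq> \<Omega>}"

text \<open>All function spaces consist of functions rather than of classes modulo null sets, and
  the values of a function outside the set \<open>\<Omega>\<close> are irrelevant.\<close>

definition Linf :: "(real^'n::finite) set \<Rightarrow> (real^'n \<Rightarrow> 'b::euclidean_space) set" where
  "Linf \<Omega> = {f. f \<in> borel_measurable (lebesgue_on \<Omega>)
      \<and> (\<exists>B. AE x in lebesgue_on \<Omega>. norm (f x) \<le> B)}"

definition L2 :: "(real^'n::finite) set \<Rightarrow> (real^'n \<Rightarrow> 'b::euclidean_space) set" where
  "L2 \<Omega> = {f. f \<in> borel_measurable (lebesgue_on \<Omega>)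
      \<and> integrable (lebesgue_on \<Omega>) (\<lambda>x. (norm (f x))\<^sup>2)}"

definition L1_loc :: "(real^'n::finite) set \<Rightarrow> (real^'n \<Rightarrow> 'b::euclidean_space) set" where
  "L1_loc \<Omega> = {f. \<forall>K. compact K \<and> K \<subseteq> \<Omega> \<longrightarrow> integrable (lebesgue_on K) f}"

text \<open>The entry \<open>G x $ i $ j\<close> is the weak derivative of the \<open>i\<close>-th component in
  the \<open>j\<close>-th direction, so \<open>norm (G x)\<close> is the Euclidean (Frobenius) norm of the gradient.\<close>

definition is_weak_gradient ::
    "(real^'n::finite) set \<Rightarrow> (real^'n \<Rightarrow> real^'m::finite) \<Rightarrow> (real^'n \<Rightarrow> real^'n^'m) \<Rightarrow> bool" where
  "is_weak_gradient \<Omega> f G \<longleftrightarrow> f \<in> L1_loc \<Omega> \<and> G \<in> L1_loc \<Omega> \<and>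
     (\<forall>\<phi>\<in>test_functions \<Omega>. \<forall>i j.
        (LINT x|lebesgue_on \<Omega>. f x $ i * partial j \<phi> x)
          = - (LINT x|lebesgue_on \<Omega>. G x $ i $ j * \<phi> x))"

text \<open>On an open set weak gradients are unique up to null sets, so the choice below does not
  affect any integral.\<close>

definition weak_gradient ::
    "(real^'n::finite) set \<Rightarrow> (real^'n \<Rightarrow> real^'m::finite) \<Rightarrow> real^'n \<Rightarrow> real^'n^'m" where
  "weak_gradient \<Omega> f = (SOME G. is_weak_gradient \<Omega> f G)"

definition W12 :: "(real^'n::finite) set \<Rightarrow> (real^'n \<Rightarrow> real^'m::finite) set" where
  "W12 \<Omega> = {f. f \<in> L2 \<Omega> \<and> (\<exists>G. is_weak_gradient \<Omega> f G \<and> G \<in> L2 \<Omega>)}"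

definition W12_norm :: "(real^'n::finite) set \<Rightarrow> (real^'n \<Rightarrow> real^'m::finite) \<Rightarrow> real" where
  "W12_norm \<Omega> f = sqrt ((LINT x|lebesgue_on \<Omega>. (norm (f x))\<^sup>2)
      + (LINT x|lebesgue_on \<Omega>. (norm (weak_gradient \<Omega> f x))\<^sup>2))"

definition W12_loc :: "(real^'n::finite) set \<Rightarrow> (real^'n \<Rightarrow> real^'m::finite) set" where
  "W12_loc U = {f. \<forall>V. open V \<and> compact (closure V) \<and> closure V \<subseteq> U \<longrightarrow> f \<in> W12 V}"

definition W12_0 :: "(real^'n::finite) set \<Rightarrow> (real^'n \<Rightarrow> real^'m::finite) set" where
  "W12_0 \<Omega> = {f. f \<in> W12 \<Omega> \<and>
     (\<exists>\<phi>. (\<forall>k i. (\<lambda>x. \<phi> k x $ i) \<in> test_functions \<Omega>)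
        \<and> (\<lambda>k::nat. W12_norm \<Omega> (\<lambda>x. \<phi> k x - f x)) \<longlonglongrightarrow> 0)}"

text \<open>Near each boundary point the set is the strict epigraph of a Lipschitz function, in the
  direction of some unit vector \<open>e\<close>, defined on the hyperplane orthogonal to \<open>e\<close>.\<close>

definition lipschitz_boundary :: "(real^'n::finite) set \<Rightarrow> bool" where
  "lipschitz_boundary \<Omega> \<longleftrightarrow> (\<forall>p\<in>frontier \<Omega>. \<exists>r>0. \<exists>e g L.
      norm e = 1 \<and> L-lipschitz_on {y. y \<bullet> e = 0} g \<and>
      \<Omega> \<inter> ball p r = {x \<in> ball p r. x \<bullet> e > g (x - (x \<bullet> e) *\<^sub>R e)})"

definition energy ::
    "(real^'m::finite \<Rightarrow> real) \<Rightarrow> (real^'n::finite) set \<Rightarrow> (real^'n \<Rightarrow> real^'m) \<Rightarrow> ennreal" where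
  "energy W \<Omega> u = (\<integral>\<^sup>+x. ennreal ((norm (weak_gradient \<Omega> u x))\<^sup>2 / 2 + W (u x)) \<partial>lebesgue_on \<Omega>)"

definition minimizer :: "(real^'m::finite \<Rightarrow> real) \<Rightarrow> (real^'n::finite \<Rightarrow> real^'m) \<Rightarrow> bool" where
  "minimizer W u \<longleftrightarrow> u \<in> W12_loc UNIV \<and> u \<in> Linf UNIV \<and>
     (\<forall>\<Omega> v. open \<Omega> \<and> bounded \<Omega> \<and> lipschitz_boundary \<Omega> \<and> v \<in> W12_0 \<Omega> \<and> v \<in> Linf \<Omega>
        \<longrightarrow> energy W \<Omega> (\<lambda>x. u x + v x) \<ge> energy W \<Omega> u)"

definition H1 :: "real \<Rightarrow> (real^'m::finite) set \<Rightarrow> (real^'m \<Rightarrow> real) \<Rightarrow> bool" where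
  "H1 \<alpha> A W \<longleftrightarrow> continuous_on UNIV W \<and> (\<forall>z. W z \<ge> 0) \<and> {z. W z = 0} = A \<and>
     (\<exists>\<rho>0>0. \<exists>c>0. \<forall>a\<in>A.
        (\<forall>\<^sub>F z in at a. W differentiable (at z)) \<and>
        (\<forall>\<rho>\<in>{0<..\<rho>0}. \<forall>\<xi>. norm \<xi> = 1 \<longrightarrow>
           (\<exists>D. ((\<lambda>r. W (a + r *\<^sub>R \<xi>)) has_real_derivative D) (at \<rho>)
              \<and> D \<ge> \<alpha> * c * \<rho> powr (\<alpha> - 1)))) \<and>
     Liminf at_infinity (\<lambda>z. ereal (W z)) > 0"

definition holder_space :: "real \<Rightarrow> (real^'n::finite \<Rightarrow> real^'m::finite) set" where
  "holder_space \<beta> = {f. bounded (range f)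
      \<and> (\<exists>K. \<forall>x y. norm (f x - f y) \<le> K * norm (x - y) powr \<beta>)}"

end

theory Submission
  imports Defs
begin

text \<open>
  Only the local boundedness of \<open>W\<close> matters. Comparing \<open>u\<close> with \<open>u + w\<close> and \<open>u - w\<close>, where \<open>w\<close> is
  a test function supported in a ball of radius \<open>R\<close> with \<open>w\<close> and \<open>\<nabla>w\<close> bounded by a fixed constant,
  gives \<open>\<bar>\<integral> u \<Delta>w\<bar> \<le> C R\<^sup>n\<close>. This says that \<open>\<Delta>u\<close> has Besov regularity of order minus one, so
  \<open>u\<close> is in the Zygmund class, and no harmonic replacement or elliptic regularity is needed.

  Concretely, a radial mollifier family \<open>\<eta>\<^sub>r\<close> is chosen with \<open>d/dr \<eta>\<^sub>r = r\<^sup>1\<^sup>-\<^sup>n \<Delta>P\<^sub>r\<close> for a bump \<open>P\<^sub>r\<close> of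
  radius \<open>r\<close>, and \<open>m r x\<close> denotes the mollification of a component of \<open>u\<close>. Testing with \<open>w = r P\<^sub>r\<close>
  shows that \<open>m r x\<close> is Lipschitz in \<open>r\<close>; testing with the difference of two such bumps centred at
  \<open>x\<close> and \<open>y\<close>, multiplied by \<open>r\<^sup>2 / \<bar>x - y\<bar>\<close>, bounds the \<open>r\<close>-derivative of \<open>m r x - m r y\<close> by
  \<open>C \<bar>x - y\<bar> / r\<close>. Integrating from \<open>r = \<bar>x - y\<bar>\<close> to \<open>r = 1\<close> produces the logarithm.
\<close>

section \<open>A smooth function algebra\<close>

text \<open>The integral bound comes from expanding the energy. For \<open>v\<close> equal to
  \<open>w\<close> or \<open>-w\<close> in one component, energy(u + v) - energy(u) is the integral
  of grad u . grad v + |grad v|^2 / 2 + W(u + v) - W(u). It is nonnegative by minimality and -W(u)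
  may be dropped, so a pointwise bound for the second and third terms bounds the cross term, up to
  sign the pairing of u with the Laplacian of w, from one side; the opposite sign of w gives the
  other side. The term |grad v|^2 is not linear in v, so the test function cannot be rescaled at
  will: the prefactors r and r^2 / |x - y| are those that keep first derivatives bounded
  independently of r, x and y.

  Two points of rigour shape the rest. The map u is given only up to null sets, so the regular
  representative has to be built: it is the limit of the mollifications as r tends to 0, which
  exists at every point, divided by the mass of the mollifier. And \<open>energy\<close> uses an
  arbitrarily chosen weak gradient. The lemma that a locally integrable function orthogonal to all
  test functions vanishes almost everywhere serves twice, to identify that limit with u and to
  replace the chosen gradient by an explicit one.\<close>

definition flat :: "nat \<Rightarrow> real \<Rightarrow> real" where
  "flat k t = (if t \<le> 0 then 0 else inverse t ^ k * exp (- inverse t))"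

lemma flat_nonpos [simp]: "t \<le> 0 \<Longrightarrow> flat k t = 0"
  by (simp add: flat_def)

lemma flat_nonneg: "0 \<le> flat k t"
  by (simp add: flat_def)

lemma flat_pos: "0 < t \<Longrightarrow> 0 < flat k t"
  by (simp add: flat_def)

text \<open>With s = 1/t this is s^k / k! <= exp s: a single term of the exponential series is at
  most its sum.\<close>

lemma flat_le_fact: "flat k t \<le> fact k"
proof (cases "t \<le> 0")
  case False
  define s where "s = inverse t"
  have s: "s > 0" using False by (simp add: s_def)
  have "s ^ k / fact k \<le> (\<Sum>i<Suc k. s ^ i / fact i)"
    by (rule member_le_sum) (use s in auto)
  also have "\<dots> \<le> exp s"
    using exp_lower_Taylor_quadratic[of s] sum_le_suminf[of "\<lambda>i. s ^ i / fact i" "{..<Suc k}"] s summable_exp[of s]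
    by (auto simp: exp_def scaleR_conv_of_real field_simps)
  finally have "s ^ k \<le> fact k * exp s" by (simp add: field_simps)
  then have "s ^ k * exp (- s) \<le> fact k" by (simp add: exp_minus field_simps)
  then show ?thesis using False by (simp add: flat_def s_def)
qed auto

lemma abs_flat_le_fact: "\<bar>flat k t\<bar> \<le> fact k"
  using flat_le_fact[of k t] flat_nonneg[of k t] by simp

lemma flat_Suc: "t * flat (Suc k) t = flat k t"
  by (auto simp: flat_def)

text \<open>Away from 0 this is the product rule. At 0 both terms on the right are 0 by definition,
  and the difference quotient must be shown to vanish.\<close>

lemma flat_has_real_derivative:
  "(flat k has_real_derivative flat (k + 2) t - real k * flat (k + 1) t) (at t)"
proof -
  consider "t < 0" | "t = 0" | "t > 0" by linarith
  then show ?thesis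
  proof cases
    case 1
    have "\<forall>\<^sub>F y in nhds t. flat k y = (\<lambda>_. 0) y"
      using eventually_nhds_in_open[of "{..<0}" t] 1 by (auto elim!: eventually_mono)
    moreover have "((\<lambda>_. 0) has_real_derivative 0) (at t)" by simp
    ultimately show ?thesis using 1 by (subst DERIV_cong_ev[OF refl _ refl]) auto
  next
    case 2
    have "((\<lambda>y. (flat k y - flat k 0) / (y - 0)) \<longlongrightarrow> 0) (at 0)"
    proof (rule Lim_null_comparison[of _ "\<lambda>y. \<bar>y\<bar> * fact (k + 2)"])
      show "\<forall>\<^sub>F y in at 0. norm ((flat k y - flat k 0) / (y - 0)) \<le> \<bar>y\<bar> * fact (k + 2)"
      proof (intro always_eventually allI)
        fix y :: real
        \<comment> \<open>Two factors y are split off: one cancels the denominator, the other drives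
          the quotient to 0 while \<open>flat (k + 2)\<close> stays bounded.\<close>
        have "flat k y = y * (y * flat (k + 2) y)" using flat_Suc[of y "Suc k"] flat_Suc[of y k] by simp
        then have "norm ((flat k y - flat k 0) / (y - 0)) = \<bar>y\<bar> * \<bar>flat (k + 2) y\<bar>"
          by (cases "y = 0") (auto simp: abs_mult)
        then show "norm ((flat k y - flat k 0) / (y - 0)) \<le> \<bar>y\<bar> * fact (k + 2)"
          using abs_flat_le_fact[of "k+2" y] by (simp add: mult_left_mono del: fact_Suc)
      qed
      show "((\<lambda>y::real. \<bar>y\<bar> * fact (k + 2)) \<longlongrightarrow> 0) (at 0)"
        by (intro tendsto_eq_intros) auto
    qed
    then show ?thesis using 2 by (simp add: has_field_derivative_iff)
  next
    case 3
    have ev: "\<forall>\<^sub>F y in nhds t. flat k y = (\<lambda>t. inverse t ^ k * exp (- inverse t)) y"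
      using eventually_nhds_in_open[of "{0<..}" t] 3 by (auto elim!: eventually_mono simp: flat_def)
    have "((\<lambda>t. inverse t ^ k * exp (- inverse t)) has_real_derivative
        flat (k + 2) t - real k * flat (k + 1) t) (at t)"
      using 3 apply (auto intro!: derivative_eq_intros simp: flat_def)
      apply (cases k)
       apply (auto simp: field_simps power2_eq_square)
      done
    then show ?thesis by (subst DERIV_cong_ev[OF refl ev refl])
  qed
qed

lemma continuous_flat: "continuous_on S (flat k)"
  using flat_has_real_derivative[of k]
  by (meson DERIV_isCont continuous_at_imp_continuous_on)

text \<open>The constant is the factorial bound for the derivative. The values that matter later are
  2 for k = 0 and 24 + 12 = 36 for k = 2.\<close>

lemma flat_lipschitz: "\<bar>flat k s - flat k t\<bar> \<le> (fact (k + 2) + real k * fact (k + 1)) * \<bar>s - t\<bar>"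
proof -
  have "norm (flat k s - flat k t) \<le> (fact (k + 2) + real k * fact (k + 1)) * norm (s - t)"
  proof (rule field_differentiable_bound[where S = UNIV])
    fix z :: real
    show "(flat k has_field_derivative flat (k + 2) z - real k * flat (k + 1) z) (at z within UNIV)"
      using flat_has_real_derivative by simp
    have "\<bar>real k * flat (k + 1) z\<bar> \<le> real k * fact (k + 1)"
      unfolding abs_mult using abs_flat_le_fact[of "k+1" z] by (intro mult_mono) auto
    then show "norm (flat (k + 2) z - real k * flat (k + 1) z) \<le> fact (k + 2) + real k * fact (k + 1)"
      using abs_flat_le_fact[of "k+2" z] unfolding real_norm_def by linarith
  qed auto
  then show ?thesis by simp
qed

lemma partial_eqI: "(f has_derivative D) (at x) \<Longrightarrow> partial j f x = D (axis j 1)"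
  unfolding partial_def by (metis frechet_derivative_at)

text \<open>This class of smooth functions is closed under partial derivatives because the derivative of
  \<open>flat k\<close> is a combination of \<open>flat (k + 2)\<close> and \<open>flat (k + 1)\<close>.\<close>

inductive_set smooth_alg :: "(real^'n::finite \<Rightarrow> real) set" where
  const: "(\<lambda>x. c) \<in> smooth_alg"
| coord: "(\<lambda>x. x $ i) \<in> smooth_alg"
| add: "f \<in> smooth_alg \<Longrightarrow> g \<in> smooth_alg \<Longrightarrow> (\<lambda>x. f x + g x) \<in> smooth_alg"
| mult: "f \<in> smooth_alg \<Longrightarrow> g \<in> smooth_alg \<Longrightarrow> (\<lambda>x. f x * g x) \<in> smooth_alg"
| flat: "f \<in> smooth_alg \<Longrightarrow> (\<lambda>x. flat k (f x)) \<in> smooth_alg"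

lemma smooth_alg_diff:
  "f \<in> smooth_alg \<Longrightarrow> g \<in> smooth_alg \<Longrightarrow> (\<lambda>x. f x - g x) \<in> smooth_alg"
  using smooth_alg.add[of f "\<lambda>x. (-1) * g x"] smooth_alg.mult[OF smooth_alg.const[of "-1"], of g] by simp

lemma smooth_alg_sum:
  "(\<And>i. i \<in> I \<Longrightarrow> f i \<in> smooth_alg) \<Longrightarrow> (\<lambda>x. \<Sum>i\<in>I. f i x) \<in> smooth_alg"
  by (induction I rule: infinite_finite_induct) (auto intro: smooth_alg.intros)

lemma smooth_alg_prod:
  "(\<And>i. i \<in> I \<Longrightarrow> f i \<in> smooth_alg) \<Longrightarrow> (\<lambda>x. \<Prod>i\<in>I. f i x) \<in> smooth_alg"
  by (induction I rule: infinite_finite_induct) (auto intro: smooth_alg.intros)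

lemma smooth_alg_norm_diff_square: "(\<lambda>z. (norm (z - x))\<^sup>2) \<in> smooth_alg"
proof -
  have "(\<lambda>z. (norm (z - x))\<^sup>2) = (\<lambda>z. \<Sum>i\<in>UNIV. (z $ i - x $ i) * (z $ i - x $ i))"
    by (simp add: fun_eq_iff power2_norm_eq_inner inner_vec_def)
  then show ?thesis
    by (simp only:) (intro smooth_alg_sum smooth_alg.mult smooth_alg_diff smooth_alg.const smooth_alg.coord)
qed

lemma smooth_alg_partial:
  fixes f :: "real^'n::finite \<Rightarrow> real"
  assumes "f \<in> smooth_alg"
  shows "(\<forall>x. f differentiable (at x)) \<and> (\<forall>j. partial j f \<in> smooth_alg)"
  using assms
proof induction
  case (const c)
  have "partial j (\<lambda>x. c) = (\<lambda>x. 0)" for j :: 'n by (rule ext, subst partial_eqI[OF has_derivative_const]) simp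
  then show ?case by (auto intro: smooth_alg.const)
next
  case (coord i)
  have d: "((\<lambda>x. x $ i) has_derivative (\<lambda>h. h $ i)) (at x)" for x :: "real^'n"
    by (rule bounded_linear_imp_has_derivative[OF bounded_linear_vec_nth])
  have "partial j (\<lambda>x. x $ i) = (\<lambda>x. axis j 1 $ i)" for j by (rule ext, subst partial_eqI[OF d]) simp
  then show ?case using d by (auto intro: smooth_alg.const simp: differentiable_def)
next
  case (add f g)
  then have d: "\<And>x. (f has_derivative frechet_derivative f (at x)) (at x)"
    "\<And>x. (g has_derivative frechet_derivative g (at x)) (at x)"
    by (auto simp: frechet_derivative_works)
  have "partial j (\<lambda>x. f x + g x) = (\<lambda>x. partial j f x + partial j g x)" for j
    by (rule ext, subst partial_eqI[OF has_derivative_add[OF d]]) (simp add: partial_def)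
  then show ?case using add by (auto intro: smooth_alg.add)
next
  case (mult f g)
  then have d: "\<And>x. (f has_derivative frechet_derivative f (at x)) (at x)"
    "\<And>x. (g has_derivative frechet_derivative g (at x)) (at x)"
    by (auto simp: frechet_derivative_works)
  have "partial j (\<lambda>x. f x * g x) = (\<lambda>x. f x * partial j g x + partial j f x * g x)" for j
    by (rule ext, subst partial_eqI[OF has_derivative_mult[OF d]]) (simp add: partial_def)
  then show ?case using mult by (auto intro!: smooth_alg.add smooth_alg.mult)
next
  case (flat f k)
  then have d: "\<And>x. (f has_derivative frechet_derivative f (at x)) (at x)"
    by (auto simp: frechet_derivative_works)
  have dd: "((\<lambda>x. flat k (f x)) has_derivative
      (\<lambda>h. frechet_derivative f (at x) h * (flat (k + 2) (f x) - real k * flat (k + 1) (f x)))) (at x)" for x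
    using has_derivative_compose[OF d flat_has_real_derivative[unfolded has_field_derivative_def]]
    by (simp add: mult.commute)
  have "partial j (\<lambda>x. flat k (f x)) =
      (\<lambda>x. partial j f x * (flat (k + 2) (f x) - real k * flat (k + 1) (f x)))" for j
    by (rule ext, subst partial_eqI[OF dd]) (simp add: partial_def)
  then show ?case using flat dd
    by (auto intro!: smooth_alg.flat smooth_alg.mult smooth_alg_diff smooth_alg.const simp: differentiable_def)
qed

lemma smooth_alg_C_k: "f \<in> smooth_alg \<Longrightarrow> C_k k f"
proof (induction k arbitrary: f)
  case 0
  then show ?case using smooth_alg_partial[OF 0]
    by (simp add: continuous_at_imp_continuous_on differentiable_imp_continuous_within)
next
  case (Suc k)
  then show ?case using smooth_alg_partial[OF Suc.prems] by simp
qed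

lemma smooth_alg_continuous: "f \<in> smooth_alg \<Longrightarrow> continuous_on S f"
  using smooth_alg_C_k[of f 0] continuous_on_subset by fastforce

lemma smooth_alg_test_function:
  assumes "f \<in> smooth_alg" "compact K" "K \<subseteq> \<Omega>" "\<And>x. x \<notin> K \<Longrightarrow> f x = 0"
  shows "f \<in> test_functions \<Omega>"
proof -
  have "closure {x. f x \<noteq> 0} \<subseteq> K"
    using assms by (intro closure_minimal) (auto simp: compact_imp_closed)
  moreover then have "compact (closure {x. f x \<noteq> 0})"
    using assms(2) compact_Int_closed[of K "closure {x. f x \<noteq> 0}"] by (simp add: inf_absorb2)
  ultimately show ?thesis
    using assms smooth_alg_C_k unfolding test_functions_def by blast
qed

section \<open>Radial bumps and mollifiers\<close>

definition laplacian :: "(real^'n::finite \<Rightarrow> real) \<Rightarrow> real^'n \<Rightarrow> real" where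
  "laplacian f x = (\<Sum>j\<in>UNIV. partial j (partial j f) x)"

text \<open>\<open>radial 0 r x\<close> is the bump P_r of the overview. Writing F =
  \<open>flat 0\<close> and q = 1 - |z - x|^2 / r^2, it is F(q); moreover \<open>radial 2\<close> is
  F'(q), and \<open>radial 4\<close> minus twice \<open>radial 3\<close> is F''(q).\<close>

definition radial :: "nat \<Rightarrow> real \<Rightarrow> real^'n::finite \<Rightarrow> real^'n \<Rightarrow> real" where
  "radial k r x z = flat k (1 - (norm (z - x))\<^sup>2 / r\<^sup>2)"

lemma radial_smooth_alg: "radial k r x \<in> smooth_alg"
proof -
  have "(\<lambda>z. flat k (1 - inverse (r\<^sup>2) * (norm (z - x))\<^sup>2)) \<in> smooth_alg"
    by (intro smooth_alg.flat smooth_alg_diff smooth_alg.const smooth_alg.mult smooth_alg_norm_diff_square)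
  then show ?thesis by (simp add: radial_def[abs_def] divide_inverse mult.commute)
qed

lemma radial_eq_0:
  assumes "r > 0" "norm (z - x) \<ge> r"
  shows "radial k r x z = 0"
proof -
  have "r\<^sup>2 \<le> (norm (z - x))\<^sup>2" using assms by (intro power_mono) auto
  then show ?thesis using assms by (simp add: radial_def)
qed

lemma smooth_algD:
  assumes "f \<in> smooth_alg"
  shows "f differentiable (at x)" "partial j f \<in> smooth_alg"
  using smooth_alg_partial[OF assms] by auto

lemma partial_diff:
  assumes "f differentiable (at x)" "g differentiable (at x)"
  shows "partial j (\<lambda>x. f x - g x) x = partial j f x - partial j g x"
  by (subst partial_eqI[OF has_derivative_diff[OF assms[unfolded frechet_derivative_works]]]) (simp add: partial_def)

lemma partial_mult:
  assumes "f differentiable (at x)" "g differentiable (at x)"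
  shows "partial j (\<lambda>x. f x * g x) x = f x * partial j g x + partial j f x * g x"
  by (subst partial_eqI[OF has_derivative_mult[OF assms[unfolded frechet_derivative_works]]]) (simp add: partial_def)

lemma partial_cmult:
  assumes "f differentiable (at x)"
  shows "partial j (\<lambda>x. c * f x) x = c * partial j f x"
  by (subst partial_eqI[OF has_derivative_mult_right[OF assms[unfolded frechet_derivative_works]]]) (simp add: partial_def)

lemma laplacian_cmult:
  assumes "f \<in> smooth_alg"
  shows "laplacian (\<lambda>x. c * f x) x = c * laplacian f x"
proof -
  have "partial j (\<lambda>x. c * f x) = (\<lambda>x. c * partial j f x)" for j
    using partial_cmult smooth_algD[OF assms] by blast
  then show ?thesis
    by (simp add: laplacian_def partial_cmult smooth_algD[OF smooth_algD(2)[OF assms]] sum_distrib_left)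
qed

lemma laplacian_diff:
  assumes "f \<in> smooth_alg" "g \<in> smooth_alg"
  shows "laplacian (\<lambda>x. f x - g x) x = laplacian f x - laplacian g x"
proof -
  have "partial j (\<lambda>x. f x - g x) = (\<lambda>x. partial j f x - partial j g x)" for j
    using partial_diff smooth_algD[OF assms(1)]  smooth_algD[OF assms(2)] by blast
  then show ?thesis
    by (simp add: laplacian_def partial_diff smooth_algD[OF smooth_algD(2)[OF assms(1)]]
        smooth_algD[OF smooth_algD(2)[OF assms(2)]] sum_subtractf)
qed

lemma radial_has_derivative:
  "(radial k r x has_derivative
     (\<lambda>h. (flat (k + 2) (1 - (norm (z - x))\<^sup>2 / r\<^sup>2) - real k * flat (k + 1) (1 - (norm (z - x))\<^sup>2 / r\<^sup>2))
        * (- (2 / r\<^sup>2) * ((z - x) \<bullet> h)))) (at z)"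
proof -
  have "((\<lambda>z. (z - x) \<bullet> (z - x)) has_derivative (\<lambda>h. 2 * ((z - x) \<bullet> h))) (at z)"
    by (auto intro!: derivative_eq_intros simp: inner_commute)
  from has_derivative_diff[OF has_derivative_const has_derivative_mult_right[OF this, of "inverse (r\<^sup>2)"], of 1]
  have "((\<lambda>z. 1 - inverse (r\<^sup>2) * ((z - x) \<bullet> (z - x))) has_derivative
      (\<lambda>h. - (2 / r\<^sup>2) * ((z - x) \<bullet> h))) (at z)"
    by (simp add: divide_inverse mult_ac)
  from has_derivative_compose[OF this flat_has_real_derivative[unfolded has_field_derivative_def]]
  show ?thesis by (simp add: radial_def[abs_def] power2_norm_eq_inner divide_inverse mult.commute[of _ "inverse _"])
qed

lemma partial_radial:
  "partial j (radial k r x) z = - (2 / r\<^sup>2) * (radial (k + 2) r x z - real k * radial (k + 1) r x z) * (z - x) $ j"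
  unfolding partial_eqI[OF radial_has_derivative] by (simp add: radial_def inner_axis) (simp add: algebra_simps)

text \<open>In the notation F(q) this is F'(q) times the Laplacian of q, which is -2n/r^2, plus
  F''(q) times |grad q|^2, which is 4|z - x|^2 / r^4.\<close>

lemma laplacian_radial:
  fixes x :: "real^'n::finite"
  shows "laplacian (radial 0 r x) z =
    - (2 / r\<^sup>2) * (real CARD('n) * radial 2 r x z
        - (2 / r\<^sup>2) * (norm (z - x))\<^sup>2 * (radial 4 r x z - 2 * radial 3 r x z))"
proof -
  have p: "partial j (radial 0 r x) = (\<lambda>z. - (2 / r\<^sup>2) * (radial 2 r x z * (z $ j - x $ j)))" for j
    by (rule ext) (simp add: partial_radial eval_nat_numeral)
  have "partial j (partial j (radial 0 r x)) z =
      - (2 / r\<^sup>2) * (radial 2 r x z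
         + - (2 / r\<^sup>2) * (radial 4 r x z - 2 * radial 3 r x z) * ((z $ j - x $ j) * (z $ j - x $ j)))" for j
  proof -
    have d1: "radial 2 r x differentiable (at z)" using radial_smooth_alg smooth_algD(1) by blast
    have c: "(\<lambda>z. z $ j - x $ j) \<in> smooth_alg" for j
      by (intro smooth_alg_diff smooth_alg.const smooth_alg.coord)
    have d2: "(\<lambda>z. z $ j - x $ j) differentiable (at z)" using c smooth_algD(1) by blast
    have d3: "(\<lambda>z. radial 2 r x z * (z $ j - x $ j)) differentiable (at z)"
      using smooth_algD(1)[OF smooth_alg.mult[OF radial_smooth_alg c]] by blast
    have "((\<lambda>z. z $ j - x $ j) has_derivative (\<lambda>h. h $ j)) (at z)"
      using has_derivative_diff[OF bounded_linear_imp_has_derivative[OF bounded_linear_vec_nth] has_derivative_const, of j "x $ j" "at z"]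
      by simp
    from partial_eqI[OF this] have p3: "partial j (\<lambda>z. z $ j - x $ j) z = 1" by simp
    have p4: "partial j (radial 2 r x) z = - (2 / r\<^sup>2) * (radial 4 r x z - 2 * radial 3 r x z) * (z $ j - x $ j)"
      by (simp add: partial_radial)
    show ?thesis unfolding p partial_cmult[OF d3] partial_mult[OF d1 d2] p3 p4
      by (simp only: mult_1_right add.commute mult.assoc)
  qed
  then have "laplacian (radial 0 r x) z = (\<Sum>j\<in>(UNIV::'n set). - (2 / r\<^sup>2) * (radial 2 r x z
         + - (2 / r\<^sup>2) * (radial 4 r x z - 2 * radial 3 r x z) * ((z $ j - x $ j) * (z $ j - x $ j))))"
    by (simp add: laplacian_def)
  also have "\<dots> = - (2 / r\<^sup>2) * (real CARD('n) * radial 2 r x z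
         + - (2 / r\<^sup>2) * (radial 4 r x z - 2 * radial 3 r x z) * (\<Sum>j\<in>(UNIV::'n set). (z $ j - x $ j) * (z $ j - x $ j)))"
    unfolding sum_distrib_left[symmetric] sum.distrib by simp
  also have "(\<Sum>j\<in>(UNIV::'n set). (z $ j - x $ j) * (z $ j - x $ j)) = (norm (z - x))\<^sup>2"
    by (simp add: power2_norm_eq_inner inner_vec_def)
  finally show ?thesis by (simp add: algebra_simps)
qed

text \<open>The profile is F'(q), not the bump F(q) itself: only with the derivative is the
  r-derivative a Laplacian. It is left unnormalised; the total mass is divided out at the very
  end.\<close>

definition mollifier :: "real \<Rightarrow> real^'n::finite \<Rightarrow> real^'n \<Rightarrow> real" where
  "mollifier r x z = inverse r ^ CARD('n) * radial 2 r x z"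

text \<open>Differentiating r^(-n) F'(q) in r gives -n r^(-n-1) F'(q) + 2 |z - x|^2 r^(-n-3) F''(q),
  which is the formula for the Laplacian of F(q) multiplied by r^(1-n) / 2.\<close>

lemma mollifier_has_real_derivative:
  fixes x :: "real^'n::finite"
  assumes "r > 0"
  shows "((\<lambda>r. mollifier r x z) has_real_derivative
     r * inverse r ^ CARD('n) / 2 * laplacian (radial 0 r x) z) (at r)"
proof -
  define N where "N = CARD('n)"
  have N: "N > 0" by (simp add: N_def)
  let ?q = "1 - (norm (z - x))\<^sup>2 / r\<^sup>2"
  have q: "((\<lambda>r. 1 - (norm (z - x))\<^sup>2 / r\<^sup>2) has_real_derivative 2 * (norm (z - x))\<^sup>2 / r ^ 3) (at r)"
    using assms by (auto intro!: derivative_eq_intros simp: field_simps eval_nat_numeral)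
  have f: "((\<lambda>r. radial 2 r x z) has_real_derivative
     (flat 4 ?q - 2 * flat 3 ?q) * (2 * (norm (z - x))\<^sup>2 / r ^ 3)) (at r)"
    using DERIV_chain'[OF q flat_has_real_derivative[of 2]] by (simp add: radial_def eval_nat_numeral mult.commute)
  have i: "((\<lambda>r. inverse r ^ N) has_real_derivative - real N * (inverse r ^ N * inverse r)) (at r)"
  proof -
    obtain n where n: "N = Suc n" using N by (cases N) auto
    have "(inverse has_real_derivative - (inverse r * inverse r)) (at r)"
      using DERIV_inverse[of r UNIV] assms by (simp add: power2_eq_square power_inverse[symmetric] numeral_2_eq_2)
    from DERIV_power[OF this, of N] show ?thesis by (simp add: n algebra_simps)
  qed
  have e: "- real N * (inverse r ^ N * inverse r) * radial 2 r x z
        + (flat 4 ?q - 2 * flat 3 ?q) * (2 * (norm (z - x))\<^sup>2 / r ^ 3) * inverse r ^ N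
    = r * inverse r ^ N / 2 * (- (2 / r\<^sup>2) * (real N * radial 2 r x z
        - (2 / r\<^sup>2) * (norm (z - x))\<^sup>2 * (radial 4 r x z - 2 * radial 3 r x z)))"
    using assms unfolding radial_def by (simp add: field_simps power2_eq_square power3_eq_cube)
  show ?thesis
    unfolding mollifier_def N_def[symmetric] laplacian_radial
    by (rule DERIV_cong[OF DERIV_mult[OF i f] e])
qed

section \<open>Integration by parts and the fundamental lemma\<close>

text \<open>By the mean value theorem the bound \<open>g\<close> for the derivative also bounds all
  difference quotients, so dominated convergence applies along every sequence tending to
  \<open>t0\<close>.\<close>

lemma has_real_derivative_integral:
  fixes f :: "real \<Rightarrow> 'a \<Rightarrow> real"
  assumes t0: "t0 \<in> {a<..<b}"
    and int: "\<And>t. t \<in> {a<..<b} \<Longrightarrow> integrable M (f t)"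
    and der: "\<And>t x. t \<in> {a<..<b} \<Longrightarrow> x \<in> space M \<Longrightarrow> ((\<lambda>t. f t x) has_real_derivative f' t x) (at t)"
    and bd: "\<And>t x. t \<in> {a<..<b} \<Longrightarrow> x \<in> space M \<Longrightarrow> \<bar>f' t x\<bar> \<le> g x"
    and g: "integrable M g" and meas: "f' t0 \<in> borel_measurable M"
  shows "((\<lambda>t. \<integral>x. f t x \<partial>M) has_real_derivative (\<integral>x. f' t0 x \<partial>M)) (at t0)"
  unfolding has_field_derivative_iff tendsto_at_iff_sequentially
proof (intro allI impI)
  fix X :: "nat \<Rightarrow> real"
  assume X: "\<forall>i. X i \<in> UNIV - {t0}" "X \<longlonglongrightarrow> t0"
  have "\<forall>\<^sub>F n in sequentially. X n \<in> {a<..<b}"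
    using X(2) t0 by (intro topological_tendstoD) auto
  \<comment> \<open>Finitely many terms of the sequence may lie outside the interval; shifting the
    index by \<open>N\<close> removes them.\<close>
  then obtain N where N: "\<And>n. n \<ge> N \<Longrightarrow> X n \<in> {a<..<b}"
    by (auto simp: eventually_sequentially)
  have "(\<lambda>n. \<integral>x. (f (X (n + N)) x - f t0 x) / (X (n + N) - t0) \<partial>M) \<longlonglongrightarrow> (\<integral>x. f' t0 x \<partial>M)"
  proof (rule integral_dominated_convergence[where w = g])
    fix n
    have XN: "X (n + N) \<in> {a<..<b}" using N by simp
    show "(\<lambda>x. (f (X (n + N)) x - f t0 x) / (X (n + N) - t0)) \<in> borel_measurable M"
      using int[OF XN] int[OF t0] by (auto dest!: borel_measurable_integrable)
    show "AE x in M. norm ((f (X (n + N)) x - f t0 x) / (X (n + N) - t0)) \<le> g x"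
    proof (rule AE_I2)
      fix x assume x: "x \<in> space M"
      have "norm (f (X (n + N)) x - f t0 x) \<le> g x * norm (X (n + N) - t0)"
        by (rule field_differentiable_bound[where S = "{a<..<b}" and f = "\<lambda>t. f t x" and f' = "\<lambda>t. f' t x"])
          (use der bd x XN t0 in \<open>auto intro: has_field_derivative_at_within\<close>)
      then show "norm ((f (X (n + N)) x - f t0 x) / (X (n + N) - t0)) \<le> g x"
        using X(1) by (simp add: divide_le_eq)
    qed
  next
    show "AE x in M. (\<lambda>n. (f (X (n + N)) x - f t0 x) / (X (n + N) - t0)) \<longlonglongrightarrow> f' t0 x"
    proof (rule AE_I2)
      fix x assume x: "x \<in> space M"
      have "(\<lambda>n. (f (X n) x - f t0 x) / (X n - t0)) \<longlonglongrightarrow> f' t0 x"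
        using der[OF t0 x] X unfolding has_field_derivative_iff tendsto_at_iff_sequentially
        by (auto simp: o_def)
      then show "(\<lambda>n. (f (X (n + N)) x - f t0 x) / (X (n + N) - t0)) \<longlonglongrightarrow> f' t0 x"
        by (rule LIMSEQ_ignore_initial_segment)
    qed
  qed (use g meas in auto)
  then have "(\<lambda>n. ((\<integral>x. f (X (n + N)) x \<partial>M) - (\<integral>x. f t0 x \<partial>M)) / (X (n + N) - t0)) \<longlonglongrightarrow> (\<integral>x. f' t0 x \<partial>M)"
    using int[OF N] int[OF t0] by simp
  then show "((\<lambda>t. ((\<integral>x. f t x \<partial>M) - (\<integral>x. f t0 x \<partial>M)) / (t - t0)) \<circ> X) \<longlonglongrightarrow> (\<integral>x. f' t0 x \<partial>M)"
    unfolding o_def by (rule LIMSEQ_offset[where k = N])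
qed

lemma integrable_continuous_compact_support:
  fixes f :: "'a::euclidean_space \<Rightarrow> real"
  assumes "continuous_on UNIV f" "compact K" "\<And>x. x \<notin> K \<Longrightarrow> f x = 0"
  shows "integrable lborel f"
proof -
  have "integrable lborel (\<lambda>x. indicator K x *\<^sub>R f x)"
    using assms by (intro borel_integrable_compact) (auto intro: continuous_on_subset)
  also have "(\<lambda>x. indicator K x *\<^sub>R f x) = f"
    using assms(3) by (auto simp: indicator_def fun_eq_iff)
  finally show ?thesis .
qed

lemma partial_eq_0_outside:
  fixes f :: "real^'n::finite \<Rightarrow> real"
  assumes "closed K" "\<And>x. x \<notin> K \<Longrightarrow> f x = 0" "x \<notin> K"
  shows "partial j f x = 0"
proof -
  have "((\<lambda>_. 0) has_derivative (\<lambda>_. 0)) (at x)" by simp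
  then have "(f has_derivative (\<lambda>_. 0)) (at x)"
    by (rule has_derivative_transform_within_open[where s = "- K"]) (use assms in auto)
  from partial_eqI[OF this] show ?thesis .
qed

lemma continuous_compact_support_bounded:
  fixes f :: "'a::euclidean_space \<Rightarrow> real"
  assumes "continuous_on UNIV f" "compact K" "\<And>x. x \<notin> K \<Longrightarrow> f x = 0"
  obtains B where "B > 0" "\<And>x. \<bar>f x\<bar> \<le> B"
proof -
  have "bounded (f ` K)"
    using assms by (intro compact_imp_bounded compact_continuous_image) (auto intro: continuous_on_subset)
  then obtain B where "B > 0" "\<And>x. x \<in> K \<Longrightarrow> \<bar>f x\<bar> \<le> B" by (auto simp: bounded_pos)
  then show ?thesis using assms(3) by (intro that[of B]) (metis abs_zero less_imp_le)+
qed

text \<open>The integral of \<open>f (x + t e)\<close> does not depend on \<open>t\<close>; differentiate it at \<open>t = 0\<close>.\<close>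

lemma integral_partial_eq_0:
  fixes f :: "real^'n::finite \<Rightarrow> real"
  assumes diff: "\<And>x. f differentiable (at x)" and cont: "continuous_on UNIV (partial j f)"
    and K: "compact K" "\<And>x. x \<notin> K \<Longrightarrow> f x = 0"
  shows "(\<integral>x. partial j f x \<partial>lborel) = 0"
proof -
  let ?e = "axis j 1 :: real^'n"
  have cf: "continuous_on UNIV f"
    using diff by (simp add: continuous_at_imp_continuous_on differentiable_imp_continuous_within)
  have p0: "partial j f x = 0" if "x \<notin> K" for x
    using partial_eq_0_outside[OF compact_imp_closed] K that by blast
  obtain B where B: "B > 0" "\<And>x. \<bar>partial j f x\<bar> \<le> B"
    using continuous_compact_support_bounded[OF cont K(1) p0] by metis
  obtain R where R: "\<And>x. x \<in> K \<Longrightarrow> norm x \<le> R"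
    using compact_imp_bounded[OF K(1)] by (auto simp: bounded_iff)
  \<comment> \<open>The translates with |t| < 1 all vanish outside one ball of radius R + 1, which
    supplies a dominating function common to all these t.\<close>
  have out: "x + t *\<^sub>R ?e \<notin> K" if "t \<in> {-1<..<1}" "x \<notin> cball 0 (R + 1)" for t x
  proof
    assume "x + t *\<^sub>R ?e \<in> K"
    from R[OF this] have "norm (x + t *\<^sub>R ?e) \<le> R" .
    moreover have "norm x \<le> norm (x + t *\<^sub>R ?e) + norm (t *\<^sub>R ?e)"
      using norm_triangle_ineq4[of "x + t *\<^sub>R ?e" "t *\<^sub>R ?e"] by simp
    moreover have "norm (t *\<^sub>R ?e) \<le> 1" using that(1) by (simp add: abs_le_iff)
    ultimately show False using that by auto
  qed
  have cc: "continuous_on UNIV (\<lambda>x. h (x + t *\<^sub>R ?e))" if "continuous_on UNIV h" for h :: "real^'n \<Rightarrow> real" and t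
    by (rule continuous_on_compose2[OF that]) (auto intro!: continuous_intros)
  have "((\<lambda>t. \<integral>x. f (x + t *\<^sub>R ?e) \<partial>lborel) has_real_derivative (\<integral>x. partial j f (x + 0 *\<^sub>R ?e) \<partial>lborel)) (at 0)"
  proof (rule has_real_derivative_integral[where a = "-1" and b = 1 and g = "\<lambda>x. B * indicator (cball 0 (R + 1)) x"
        and f' = "\<lambda>t x. partial j f (x + t *\<^sub>R ?e)"])
    show "integrable lborel (\<lambda>x. f (x + t *\<^sub>R ?e))" if "t \<in> {-1<..<1}" for t
      using out[OF that] K(2) by (intro integrable_continuous_compact_support[of _ "cball 0 (R + 1)"] cc cf) auto
    show "((\<lambda>t. f (x + t *\<^sub>R ?e)) has_real_derivative partial j f (x + t *\<^sub>R ?e)) (at t)" for t x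
    proof -
      have "((\<lambda>t. x + t *\<^sub>R ?e) has_derivative (\<lambda>t. t *\<^sub>R ?e)) (at t)"
        by (auto intro!: derivative_eq_intros)
      from has_derivative_compose[OF this diff[unfolded frechet_derivative_works]]
      have "((\<lambda>t. f (x + t *\<^sub>R ?e)) has_derivative
          (\<lambda>h. frechet_derivative f (at (x + t *\<^sub>R ?e)) (h *\<^sub>R ?e))) (at t)" .
      moreover have "linear (frechet_derivative f (at (x + t *\<^sub>R ?e)))"
        using diff by (rule linear_frechet_derivative)
      then have "(\<lambda>h. frechet_derivative f (at (x + t *\<^sub>R ?e)) (h *\<^sub>R ?e)) = (*) (partial j f (x + t *\<^sub>R ?e))"
        by (simp add: partial_def linear_scale fun_eq_iff)
      ultimately show ?thesis by (simp add: has_field_derivative_def)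
    qed
    show "\<bar>partial j f (x + t *\<^sub>R ?e)\<bar> \<le> B * indicator (cball 0 (R + 1)) x" if "t \<in> {-1<..<1}" for t x
      using B out[OF that, of x] p0 by (cases "x \<in> cball 0 (R + 1)") auto
    show "integrable lborel (\<lambda>x::real^'n. B * indicator (cball 0 (R + 1)) x :: real)"
      using emeasure_bounded_finite[OF bounded_cball, of "0 :: real^'n" "R + 1"]
      by (intro integrable_mult_right integrable_real_indicator) auto
    show "(\<lambda>x. partial j f (x + 0 *\<^sub>R ?e)) \<in> borel_measurable lborel"
      using borel_measurable_continuous_onI[OF cont] by simp
  qed auto
  moreover have "(\<integral>x. f (x + t *\<^sub>R ?e) \<partial>lborel) = (\<integral>x. f x \<partial>lborel)" for t
  proof -
    have "(\<integral>x. f x \<partial>lborel) = (\<integral>x. f x \<partial>distr lborel borel ((+) (t *\<^sub>R ?e)))"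
      by (simp add: lborel_distr_plus)
    also have "\<dots> = (\<integral>x. f (t *\<^sub>R ?e + x) \<partial>lborel)"
      using borel_measurable_continuous_onI[OF cf] by (subst integral_distr) auto
    finally show ?thesis by (simp add: add.commute)
  qed
  ultimately have "((\<lambda>t. \<integral>x. f x \<partial>lborel) has_real_derivative (\<integral>x. partial j f x \<partial>lborel)) (at 0)" by simp
  moreover have "((\<lambda>t::real. \<integral>x. f x \<partial>lborel) has_real_derivative 0) (at 0)" by simp
  ultimately show ?thesis by (rule DERIV_unique)
qed

section \<open>Functions orthogonal to all test functions vanish almost everywhere\<close>

lemma box_indicator_smooth_approx:
  fixes a b :: "real^'n::finite"
  obtains \<phi> :: "nat \<Rightarrow> real^'n \<Rightarrow> real"
  where "\<And>k. \<phi> k \<in> smooth_alg" "\<And>k x. 0 \<le> \<phi> k x" "\<And>k x. \<phi> k x \<le> 1"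
    "\<And>k x. x \<notin> box a b \<Longrightarrow> \<phi> k x = 0"
    "\<And>x. (\<lambda>k. \<phi> k x) \<longlonglongrightarrow> indicator (box a b) x"
proof
  \<comment> \<open>Each factor exp(-1/(k s)) tends to 1 when s > 0 and is 0 when s <= 0, so the
    product converges to the indicator of the open box without any normalisation.\<close>
  let ?\<phi> = "\<lambda>k x. \<Prod>i\<in>UNIV. flat 0 (real k * (x $ i - a $ i)) * flat 0 (real k * (b $ i - x $ i))"
  have f1: "flat 0 t \<le> 1" for t using flat_le_fact[of 0] by simp
  show "?\<phi> k \<in> smooth_alg" for k
    by (intro smooth_alg_prod smooth_alg.mult smooth_alg.flat smooth_alg_diff smooth_alg.const smooth_alg.coord)
  show "0 \<le> ?\<phi> k x" for k x by (intro prod_nonneg) (auto simp: flat_nonneg)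
  show "?\<phi> k x \<le> 1" for k x
    using f1 flat_nonneg by (intro prod_le_1) (auto intro!: mult_le_one)
  show 0: "?\<phi> k x = 0" if "x \<notin> box a b" for k x
    using that by (auto simp: mem_box_cart not_less intro!: flat_nonpos mult_nonneg_nonpos)
  show "(\<lambda>k. ?\<phi> k x) \<longlonglongrightarrow> indicator (box a b) x" for x
  proof (cases "x \<in> box a b")
    case True
    have lim: "(\<lambda>k. flat 0 (real k * t)) \<longlonglongrightarrow> 1" if "t > 0" for t
    proof -
      have "(\<lambda>k. exp (- inverse (real k * t))) \<longlonglongrightarrow> exp (- 0)"
        using that
        by (intro tendsto_exp tendsto_minus tendsto_inverse_0_at_top filterlim_at_top_mult_tendsto_pos[OF tendsto_const]
            filterlim_real_sequentially) auto
      moreover have "\<forall>\<^sub>F k in sequentially. exp (- inverse (real k * t)) = flat 0 (real k * t)"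
        using eventually_gt_at_top[of 0] by eventually_elim (use that in \<open>auto simp: flat_def mult_le_0_iff\<close>)
      ultimately show ?thesis using Lim_transform_eventually by fastforce
    qed
    have "(\<lambda>k. ?\<phi> k x) \<longlonglongrightarrow> (\<Prod>i\<in>(UNIV::'n set). 1 * 1)"
      using True by (intro tendsto_prod tendsto_mult lim) (auto simp: mem_box_cart)
    then show ?thesis using True by simp
  next
    case False
    then have "(\<lambda>k. ?\<phi> k x) = (\<lambda>k. indicator (box a b) x)"
      by (intro ext, subst 0[OF False]) (use False in simp)
    then show ?thesis by (simp only: tendsto_const)
  qed
qed


lemma test_functionsD:
  assumes "\<phi> \<in> test_functions \<Omega>"
  obtains K where "compact K" "K \<subseteq> \<Omega>" "\<And>x. x \<notin> K \<Longrightarrow> \<phi> x = 0"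
    "continuous_on UNIV \<phi>" "\<And>x. \<phi> differentiable (at x)" "\<And>j. continuous_on UNIV (partial j \<phi>)"
proof (rule that[of "closure {x. \<phi> x \<noteq> 0}"])
  have C: "C_k k \<phi>" for k using assms by (auto simp: test_functions_def)
  show "continuous_on UNIV \<phi>" "\<phi> differentiable (at x)" "continuous_on UNIV (partial j \<phi>)" for x j
    using C[of 0] C[of "Suc 0"] by auto
  show "\<phi> x = 0" if "x \<notin> closure {x. \<phi> x \<noteq> 0}" for x
    using that closure_subset[of "{x. \<phi> x \<noteq> 0}"] by auto
qed (use assms in \<open>auto simp: test_functions_def\<close>)

lemma L1_locD:
  fixes g :: "real^'n::finite \<Rightarrow> real"
  assumes "g \<in> L1_loc \<Omega>" "compact K" "K \<subseteq> \<Omega>"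
  shows "integrable lebesgue (\<lambda>x. indicator K x * g x)"
proof -
  have "K \<in> sets lebesgue" using lmeasurable_compact[OF assms(2)] by (rule fmeasurableD)
  moreover have "integrable (lebesgue_on K) g" using assms by (auto simp: L1_loc_def)
  ultimately show ?thesis by (simp add: integrable_restrict_space)
qed

text \<open>The smooth approximations of the indicator are supported in the closed box, which is
  compact in \<Omega>, so they are admissible; |g| restricted to that box dominates.\<close>

lemma integral_box_eq_0:
  fixes g :: "real^'n::finite \<Rightarrow> real"
  assumes Om: "open \<Omega>" and g: "g \<in> L1_loc \<Omega>"
    and test: "\<And>\<phi>. \<phi> \<in> test_functions \<Omega> \<Longrightarrow> (LINT x|lebesgue_on \<Omega>. g x * \<phi> x) = 0"
    and sub: "cbox a b \<subseteq> \<Omega>"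
  shows "(LINT x:box a b|lebesgue. g x) = 0"
proof -
  obtain \<phi> where \<phi>: "\<And>k. \<phi> k \<in> smooth_alg" "\<And>k x. 0 \<le> \<phi> k x" "\<And>k x. \<phi> k x \<le> 1"
    "\<And>k x. x \<notin> box a b \<Longrightarrow> \<phi> k x = 0"
    "\<And>x. (\<lambda>k. \<phi> k x) \<longlonglongrightarrow> indicator (box a b) x"
    using box_indicator_smooth_approx[of a b] by blast
  have ig: "integrable lebesgue (\<lambda>x. indicator (cbox a b) x * g x)"
    by (rule L1_locD[OF g compact_cbox sub])
  have eq: "indicator \<Omega> x * (g x * \<phi> k x) = (indicator (cbox a b) x * g x) * \<phi> k x" for k x
    using \<phi>(4)[of x k] box_subset_cbox[of a b] sub by (auto simp: indicator_def)
  have [measurable]: "\<phi> k \<in> borel_measurable lebesgue" for k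
    using borel_measurable_continuous_onI[OF smooth_alg_continuous[OF \<phi>(1)]] by (simp add: measurable_completion)
  have "\<phi> k \<in> test_functions \<Omega>" for k
    using \<phi>(4) box_subset_cbox[of a b] sub by (intro smooth_alg_test_function[OF \<phi>(1), of "cbox a b"]) auto
  from test[OF this] have "(LINT x|lebesgue. (indicator (cbox a b) x * g x) * \<phi> k x) = 0" for k
    using Om by (simp add: integral_restrict_space eq)
  moreover have "(\<lambda>k. LINT x|lebesgue. (indicator (cbox a b) x * g x) * \<phi> k x) \<longlonglongrightarrow>
      (LINT x|lebesgue. (indicator (cbox a b) x * g x) * indicator (box a b) x)"
  proof (rule integral_dominated_convergence[where w = "\<lambda>x. \<bar>indicator (cbox a b) x * g x\<bar>"])
    show "AE x in lebesgue. (\<lambda>k. (indicator (cbox a b) x * g x) * \<phi> k x) \<longlonglongrightarrow>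
      (indicator (cbox a b) x * g x) * indicator (box a b) x"
      by (intro AE_I2 tendsto_mult tendsto_const \<phi>(5))
    show "AE x in lebesgue. norm ((indicator (cbox a b) x * g x) * \<phi> k x) \<le> \<bar>indicator (cbox a b) x * g x\<bar>" for k
      unfolding real_norm_def abs_mult[of _ "\<phi> k _"]
      using \<phi>(2,3) by (intro AE_I2 mult_left_le) auto
    show "(\<lambda>x. (indicator (cbox a b) x * g x) * indicator (box a b) x) \<in> borel_measurable lebesgue"
      by (rule borel_measurable_times[OF borel_measurable_integrable[OF ig] borel_measurable_indicator]) simp
    show "(\<lambda>x. (indicator (cbox a b) x * g x) * \<phi> k x) \<in> borel_measurable lebesgue" for k
      by (rule borel_measurable_times[OF borel_measurable_integrable[OF ig]]) simp
  qed (use ig in auto)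
  ultimately have "(LINT x|lebesgue. (indicator (cbox a b) x * g x) * indicator (box a b) x) = 0"
    by (simp add: LIMSEQ_const_iff)
  moreover have "(indicator (cbox a b) x * g x) * indicator (box a b) x = indicator (box a b) x *\<^sub>R g x" for x
    using box_subset_cbox[of a b] by (auto simp: indicator_def)
  ultimately show ?thesis by (simp add: set_lebesgue_integral_def)
qed

text \<open>A Dynkin system argument: open boxes are stable under intersection and generate the
  Borel sets. The integral over the whole space is assumed separately, as the case of complements
  needs it and the whole space is not a bounded box. Vanishing over all Borel sets identifies
  \<open>g\<close> with the density 0.\<close>

lemma AE_0_if_integral_box_eq_0:
  fixes g :: "'a::euclidean_space \<Rightarrow> real"
  assumes g: "integrable lborel g" and box: "\<And>a b. (LINT x:box a b|lborel. g x) = 0"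
    and univ: "(LINT x|lborel. g x) = 0"
  shows "AE x in lborel. g x = 0"
proof -
  have int: "set_integrable lborel A g" if "A \<in> sets borel" for A
    using integrable_mult_indicator[of A lborel g] g that by (simp add: set_integrable_def)
  have "(LINT x:A|lborel. g x) = 0" if "A \<in> sets borel" for A
  proof -
    have "Int_stable (range (\<lambda>(a, b). box a b :: 'a set))"
      by (auto simp: Int_stable_def box_Int_box)
    moreover have "range (\<lambda>(a, b). box a b :: 'a set) \<subseteq> Pow UNIV" by simp
    moreover have "A \<in> sigma_sets UNIV (range (\<lambda>(a, b). box a b))"
      using that by (simp add: borel_eq_box)
    ultimately have "A \<in> sets borel \<and> (LINT x:A|lborel. g x) = 0"
    proof (induction rule: sigma_sets_induct_disjoint)
      case (basic A)
      then show ?case using box by auto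
    next
      case empty
      show ?case by (simp add: set_lebesgue_integral_def)
    next
      case (compl A)
      have "(\<lambda>x. indicator (UNIV - A) x *\<^sub>R g x) = (\<lambda>x. g x - indicator A x *\<^sub>R g x)"
        by (auto simp: fun_eq_iff split: split_indicator)
      then have "(LINT x:UNIV - A|lborel. g x) = (LINT x|lborel. g x) - (LINT x:A|lborel. g x)"
        using g int[of A] compl by (simp add: set_lebesgue_integral_def set_integrable_def)
      then show ?case using compl univ by auto
    next
      case (union A)
      have "(LINT x:(\<Union>i. A i)|lborel. g x) = (\<Sum>i. (LINT x:A i|lborel. g x))"
        using union by (intro lebesgue_integral_countable_add int) (auto simp: disjoint_family_on_def)
      then show ?case using union by auto
    qed
    then show ?thesis by simp
  qed
  then show ?thesis
    by (intro density_unique_real[OF g, of "\<lambda>_. 0"]) auto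
qed

text \<open>Cutting \<open>g\<close> off to an open box makes it integrable, and since boxes
  intersect in boxes all its box integrals vanish. Countably many closed boxes cover \<Omega>, and
  their boundaries are null sets.\<close>

lemma AE_0_if_orthogonal_test_functions:
  fixes g :: "real^'n::finite \<Rightarrow> real"
  assumes Om: "open \<Omega>" and g: "g \<in> L1_loc \<Omega>"
    and test: "\<And>\<phi>. \<phi> \<in> test_functions \<Omega> \<Longrightarrow> (LINT x|lebesgue_on \<Omega>. g x * \<phi> x) = 0"
  shows "AE x in lebesgue_on \<Omega>. g x = 0"
proof -
  have on_box: "AE x in lebesgue. x \<in> cbox c d \<longrightarrow> g x = 0" if cd: "cbox c d \<subseteq> \<Omega>" for c d
  proof -
    define h where "h x = indicator (box c d) x * g x" for x
    have "integrable lebesgue (\<lambda>x. indicator (cbox c d) x * g x)"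
      by (rule L1_locD[OF g compact_cbox cd])
    from integrable_mult_indicator[OF _ this, of "box c d"]
    have "integrable lebesgue (\<lambda>x. indicator (box c d) x * (indicator (cbox c d) x * g x))" by simp
    also have "(\<lambda>x. indicator (box c d) x * (indicator (cbox c d) x * g x)) = h"
      using box_subset_cbox[of c d] by (auto simp: h_def fun_eq_iff split: split_indicator)
    finally have ih: "integrable lebesgue h" .
    \<comment> \<open>The generator argument runs over Borel sets and \<open>lborel\<close>, whereas
      \<open>h\<close> is only Lebesgue measurable, so a Borel function equal to it almost
      everywhere takes its place.\<close>
    then obtain h' where h'[measurable]: "h' \<in> borel_measurable borel" and ae: "AE x in lborel. h x = h' x"
      using completion_ex_borel_measurable_real[of h lborel] by (auto dest: borel_measurable_integrable)
    have ae': "AE x in lebesgue. h x = h' x" using ae by (rule AE_completion)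
    have ih': "integrable lborel h'"
      using integrable_cong_AE_imp[OF ih _ ae'] integrable_completion[of h' lborel]
      by (simp add: measurable_completion)
    have set: "(LINT x:A|lborel. h' x) = (LINT x:A|lebesgue. h x)" if "A \<in> sets borel" for A
    proof -
      have "(LINT x:A|lborel. h' x) = (LINT x:A|lebesgue. h' x)"
        unfolding set_lebesgue_integral_def using that by (subst integral_completion) auto
      also have "\<dots> = (LINT x:A|lebesgue. h x)"
        using ae' that ih unfolding set_lebesgue_integral_def
        by (intro integral_cong_AE)
          (auto dest: borel_measurable_integrable intro!: borel_measurable_times borel_measurable_indicator simp: measurable_completion)
      finally show ?thesis .
    qed
    have 0: "(LINT x:box a b|lebesgue. h x) = 0" for a b
    proof -
      have "(LINT x:box a b|lebesgue. h x) = (LINT x:box a b \<inter> box c d|lebesgue. g x)"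
        unfolding set_lebesgue_integral_def h_def
        by (intro Bochner_Integration.integral_cong) (auto simp: indicator_def)
      also have "\<dots> = 0"
      proof (cases "box a b \<inter> box c d = {}")
        case False
        then obtain p q where pq: "box a b \<inter> box c d = box p q" by (auto simp: box_Int_box)
        then have "closure (box p q) \<subseteq> cbox c d"
          using box_subset_cbox[of c d] by (intro closure_minimal) auto
        then have "cbox p q \<subseteq> \<Omega>" using False pq cd by (simp add: closure_box)
        from integral_box_eq_0[OF Om g test this] show ?thesis by (simp add: pq)
      qed (simp add: set_lebesgue_integral_def)
      finally show ?thesis .
    qed
    have "AE x in lborel. h' x = 0"
    proof (rule AE_0_if_integral_box_eq_0[OF ih'])
      show "(LINT x:box a b|lborel. h' x) = 0" for a b by (simp add: set 0)
      have "(LINT x|lborel. h' x) = (LINT x:UNIV|lebesgue. h x)"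
        by (subst set[symmetric]) (auto simp: set_lebesgue_integral_def)
      also have "\<dots> = (LINT x:box c d|lebesgue. h x)"
        unfolding set_lebesgue_integral_def h_def
        by (intro Bochner_Integration.integral_cong) (auto simp: indicator_def)
      finally show "(LINT x|lborel. h' x) = 0" by (simp add: 0)
    qed
    from AE_completion[OF this] have "AE x in lebesgue. h x = 0" using ae' by eventually_elim simp
    moreover have "AE x in lebesgue. x \<notin> cbox c d - box c d"
    proof (rule AE_not_in)
      have "negligible (cbox c d - box c d)" by (rule negligible_frontier_interval)
      then show "cbox c d - box c d \<in> null_sets lebesgue" by (simp add: negligible_iff_null_sets)
    qed
    ultimately show ?thesis by eventually_elim (auto simp: h_def)
  qed
  obtain \<D> where D: "countable \<D>" "\<D> \<subseteq> Pow \<Omega>" "\<And>X. X \<in> \<D> \<Longrightarrow> \<exists>a b. X = cbox a b" "\<Union>\<D> = \<Omega>"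
    using open_countable_Union_open_cbox[OF Om] by metis
  have "AE x in lebesgue. \<forall>X\<in>\<D>. x \<in> X \<longrightarrow> g x = 0"
  proof (subst AE_ball_countable[OF D(1)], intro ballI)
    fix X assume "X \<in> \<D>"
    then obtain a b where "X = cbox a b" "cbox a b \<subseteq> \<Omega>" using D by blast
    then show "AE x in lebesgue. x \<in> X \<longrightarrow> g x = 0" using on_box by simp
  qed
  then have "AE x in lebesgue. x \<in> \<Omega> \<longrightarrow> g x = 0"
    by eventually_elim (use D(4) in blast)
  then show ?thesis using Om by (simp add: AE_restrict_space_iff)
qed

section \<open>Uniform bounds for the bumps, their differences and the mollifier\<close>

lemma abs_radial_le: "\<bar>radial k r x z\<bar> \<le> fact k"
  by (simp add: radial_def abs_flat_le_fact)

lemma radial_nonneg: "0 \<le> radial k r x z"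
  by (simp add: radial_def flat_nonneg)

text \<open>If z is closer than r to one centre, the triangle inequality puts it within 2r of the
  other. In the remaining case both bumps vanish at z, so differences need estimating only near the
  centres.\<close>

lemma radial_cases:
  fixes x y z :: "real^'n::finite"
  assumes "r > 0" "norm (x - y) \<le> r"
  obtains "norm (z - x) \<ge> r" "norm (z - y) \<ge> r" | "norm (z - x) \<le> 2 * r" "norm (z - y) \<le> 2 * r"
proof -
  have "norm (z - x) \<le> norm (z - y) + norm (x - y)" "norm (z - y) \<le> norm (z - x) + norm (x - y)"
    using norm_triangle_ineq4[of "z - y" "x - y"] norm_triangle_ineq[of "z - x" "x - y"] by simp_all
  then show ?thesis using assms that by linarith
qed

text \<open>The Lipschitz bound for \<open>flat k\<close> reduces this to the arguments, and | |z -
  x|^2 - |z - y|^2 | <= |x - y| * 4r when z is within 2r of both centres.\<close>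

lemma radial_diff_le:
  fixes x y z :: "real^'n::finite"
  assumes "r > 0" "norm (x - y) \<le> r"
  shows "\<bar>radial k r x z - radial k r y z\<bar> \<le> (fact (k + 2) + real k * fact (k + 1)) * (4 * norm (x - y) / r)"
proof (rule radial_cases[OF assms, of z])
  assume "norm (z - x) \<ge> r" "norm (z - y) \<ge> r"
  then show ?thesis using assms by (simp add: radial_eq_0)
next
  assume le: "norm (z - x) \<le> 2 * r" "norm (z - y) \<le> 2 * r"
  let ?a = "norm (z - x)" and ?b = "norm (z - y)"
  have "\<bar>?b - ?a\<bar> \<le> norm (x - y)" using norm_triangle_ineq3[of "z - y" "z - x"] by simp
  then have "\<bar>?b - ?a\<bar> * \<bar>?b + ?a\<bar> \<le> norm (x - y) * (4 * r)"
    using le by (intro mult_mono) auto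
  moreover have "?b\<^sup>2 - ?a\<^sup>2 = (?b - ?a) * (?b + ?a)" by (simp add: power2_eq_square algebra_simps)
  ultimately have "\<bar>?b\<^sup>2 - ?a\<^sup>2\<bar> \<le> norm (x - y) * (4 * r)" by (simp add: abs_mult)
  then have "\<bar>?b\<^sup>2 - ?a\<^sup>2\<bar> / r\<^sup>2 \<le> norm (x - y) * (4 * r) / r\<^sup>2"
    using assms(1) by (intro divide_right_mono) auto
  also have "norm (x - y) * (4 * r) / r\<^sup>2 = 4 * norm (x - y) / r"
    using assms(1) by (simp add: power2_eq_square)
  finally have "\<bar>(1 - ?a\<^sup>2 / r\<^sup>2) - (1 - ?b\<^sup>2 / r\<^sup>2)\<bar> \<le> 4 * norm (x - y) / r"
    by (simp add: diff_divide_distrib[symmetric] abs_divide)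
  then show ?thesis unfolding radial_def
    by (intro order.trans[OF flat_lipschitz] mult_left_mono) auto
qed

text \<open>Up to a factor these products are the partial derivatives of bumps, so this controls the
  gradient of a difference of two bumps. For k = 2 the constant is 8 * 36 + 2 = 290.\<close>

lemma radial_component_diff_le:
  fixes x y z :: "real^'n::finite"
  assumes "r > 0" "norm (x - y) \<le> r"
  shows "\<bar>radial k r x z * (z - x) $ j - radial k r y z * (z - y) $ j\<bar>
    \<le> (8 * (fact (k + 2) + real k * fact (k + 1)) + fact k) * norm (x - y)"
proof (rule radial_cases[OF assms, of z])
  assume "norm (z - x) \<ge> r" "norm (z - y) \<ge> r"
  then show ?thesis using assms by (simp add: radial_eq_0)
next
  let ?L = "fact (k + 2) + real k * fact (k + 1)"
  assume le: "norm (z - x) \<le> 2 * r" "norm (z - y) \<le> 2 * r"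
  have "radial k r x z * (z - x) $ j - radial k r y z * (z - y) $ j =
      (radial k r x z - radial k r y z) * (z - x) $ j - radial k r y z * (x - y) $ j"
    by (simp add: algebra_simps)
  also have "\<bar>\<dots>\<bar> \<le> \<bar>radial k r x z - radial k r y z\<bar> * \<bar>(z - x) $ j\<bar> + \<bar>radial k r y z\<bar> * \<bar>(x - y) $ j\<bar>"
    by (rule order.trans[OF abs_triangle_ineq4]) (simp add: abs_mult)
  also have "\<dots> \<le> (?L * (4 * norm (x - y) / r)) * (2 * r) + fact k * norm (x - y)"
    using le assms radial_diff_le[OF assms, of k z] abs_radial_le[of k r y z]
      component_le_norm_cart[of "z - x" j] component_le_norm_cart[of "x - y" j]
    by (intro add_mono mult_mono) auto
  also have "\<dots> = (8 * ?L + fact k) * norm (x - y)"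
    using assms(1) by (simp add: field_simps)
  finally show ?thesis .
qed

text \<open>On the support |z - x|^2 <= r^2, and the factorial bounds give 2 for F' and 4! + 2 * 3!
  = 36 for F''. The result is (2 / r^2) * (2n + 2 * 36).\<close>

lemma abs_laplacian_radial_le:
  fixes x :: "real^'n::finite"
  assumes "r > 0"
  shows "\<bar>laplacian (radial 0 r x) z\<bar> \<le> (4 * real CARD('n) + 144) / r\<^sup>2 * indicator (cball x r) z"
proof (cases "norm (z - x) < r")
  case False
  then show ?thesis using assms by (simp add: laplacian_radial radial_eq_0)
next
  case True
  have "(norm (z - x))\<^sup>2 \<le> r\<^sup>2" using True by (intro power_mono) auto
  then have "2 / r\<^sup>2 * (norm (z - x))\<^sup>2 \<le> 2" using assms by (simp add: field_simps)
  moreover have "\<bar>radial 4 r x z - 2 * radial 3 r x z\<bar> \<le> 36"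
    using abs_radial_le[of 4 r x z] abs_radial_le[of 3 r x z] by (simp add: fact_numeral)
  ultimately have "2 / r\<^sup>2 * (norm (z - x))\<^sup>2 * \<bar>radial 4 r x z - 2 * radial 3 r x z\<bar> \<le> 2 * 36"
    by (intro mult_mono) auto
  moreover have "real CARD('n) * \<bar>radial 2 r x z\<bar> \<le> real CARD('n) * 2"
    using abs_radial_le[of 2 r x z] by (intro mult_left_mono) (auto simp: fact_numeral)
  moreover have "\<bar>real CARD('n) * radial 2 r x z - 2 / r\<^sup>2 * (norm (z - x))\<^sup>2 * (radial 4 r x z - 2 * radial 3 r x z)\<bar>
     \<le> real CARD('n) * \<bar>radial 2 r x z\<bar> + 2 / r\<^sup>2 * (norm (z - x))\<^sup>2 * \<bar>radial 4 r x z - 2 * radial 3 r x z\<bar>"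
    by (rule order.trans[OF abs_triangle_ineq4]) (simp add: abs_mult)
  ultimately have "\<bar>real CARD('n) * radial 2 r x z - 2 / r\<^sup>2 * (norm (z - x))\<^sup>2 * (radial 4 r x z - 2 * radial 3 r x z)\<bar>
     \<le> 2 * real CARD('n) + 72" by linarith
  then have "2 / r\<^sup>2 * \<bar>real CARD('n) * radial 2 r x z - 2 / r\<^sup>2 * (norm (z - x))\<^sup>2 * (radial 4 r x z - 2 * radial 3 r x z)\<bar>
     \<le> 2 / r\<^sup>2 * (2 * real CARD('n) + 72)" by (intro mult_left_mono) auto
  moreover have "2 / r\<^sup>2 * (2 * real CARD('n) + 72) = (4 * real CARD('n) + 144) / r\<^sup>2" by simp
  moreover have "z \<in> cball x r" using True by (simp add: dist_norm norm_minus_commute)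
  moreover have "\<bar>- (2 / r\<^sup>2) * a\<bar> = 2 / r\<^sup>2 * \<bar>a\<bar>" for a by (simp add: abs_mult)
  ultimately show ?thesis unfolding laplacian_radial by (simp only: indicator_simps mult_1_right)
qed

lemma continuous_laplacian:
  assumes "f \<in> smooth_alg"
  shows "continuous_on S (laplacian f)"
  unfolding laplacian_def[abs_def]
  by (intro continuous_intros smooth_alg_continuous smooth_algD(2) assms)

lemma mollifier_measurable [measurable]: "mollifier r x \<in> borel_measurable borel"
  using borel_measurable_continuous_onI[OF smooth_alg_continuous[OF radial_smooth_alg]]
  unfolding mollifier_def[abs_def] by measurable

lemma laplacian_radial_measurable [measurable]: "laplacian (radial k r x) \<in> borel_measurable borel"
  by (intro borel_measurable_continuous_onI continuous_laplacian radial_smooth_alg)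

lemma mollifier_nonneg: "r > 0 \<Longrightarrow> 0 \<le> mollifier r x z"
  by (simp add: mollifier_def radial_def flat_nonneg)

lemma mollifier_le:
  fixes x :: "real^'n::finite"
  assumes "r > 0"
  shows "mollifier r x z \<le> 2 * inverse r ^ CARD('n) * indicator (cball x r) z"
proof (cases "norm (z - x) < r")
  case False
  then show ?thesis using assms by (simp add: mollifier_def radial_eq_0)
next
  case True
  then have "z \<in> cball x r" by (simp add: dist_norm norm_minus_commute)
  then show ?thesis using assms abs_radial_le[of 2 r x z] by (simp add: mollifier_def fact_numeral field_simps)
qed

lemma integrable_indicator_cball: "integrable lborel (\<lambda>z. c * indicator (cball x r) z :: real)"
  for x :: "'a::euclidean_space"
  using emeasure_bounded_finite[OF bounded_cball, of x r]
  by (intro integrable_mult_right integrable_real_indicator) auto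

text \<open>The integral of every mollifier, whatever its radius and centre. It depends only on the
  dimension, hence the type argument.\<close>

definition mollifier_mass :: "'n::finite itself \<Rightarrow> real" where
  "mollifier_mass _ = (LINT w|lborel. radial 2 1 (0 :: real^'n) w)"

lemma radial_affine: "r > 0 \<Longrightarrow> radial k r x (x + r *\<^sub>R w) = radial k 1 0 w"
  by (simp add: radial_def power_mult_distrib)

text \<open>Substituting z = x + r w, the Jacobian r^n cancels the prefactor of the
  mollifier.\<close>

lemma integral_mollifier_mult:
  fixes x :: "real^'n::finite"
  assumes r: "r > 0" and h[measurable]: "h \<in> borel_measurable borel"
  shows "(LINT z|lborel. mollifier r x z * h z) = (LINT w|lborel. radial 2 1 0 w * (h (x + r *\<^sub>R w) :: real))"
proof -
  have [measurable]: "radial 2 1 (0::real^'n) \<in> borel_measurable borel"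
    using borel_measurable_continuous_onI[OF smooth_alg_continuous[OF radial_smooth_alg]] .
  have "(LINT z|lborel. mollifier r x z * h z) =
      (LINT z|density (distr lborel borel (\<lambda>w. x + r *\<^sub>R w)) (\<lambda>_. ennreal (\<bar>r\<bar> ^ DIM(real^'n))). mollifier r x z * h z)"
    using lborel_affine[of r x] r by simp
  also have "\<dots> = (LINT w|lborel. \<bar>r\<bar> ^ DIM(real^'n) * (mollifier r x (x + r *\<^sub>R w) * h (x + r *\<^sub>R w)))"
    by (subst integral_density) (auto simp: integral_distr)
  also have "\<dots> = (LINT w|lborel. radial 2 1 0 w * h (x + r *\<^sub>R w))"
    using r by (intro Bochner_Integration.integral_cong) (auto simp: mollifier_def radial_affine power_mult_distrib[symmetric])
  finally show ?thesis .
qed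

lemma integrable_mollifier: "r > 0 \<Longrightarrow> integrable lborel (mollifier r x)" for x :: "real^'n::finite"
  by (rule Bochner_Integration.integrable_bound[OF integrable_indicator_cball[of "2 * inverse r ^ CARD('n)" x r]])
    (auto simp: mollifier_nonneg intro!: order.trans[OF mollifier_le])

lemma integral_mollifier:
  fixes x :: "real^'n::finite"
  assumes "r > 0"
  shows "(LINT z|lborel. mollifier r x z) = mollifier_mass TYPE('n)"
  using integral_mollifier_mult[OF assms, of "\<lambda>_. 1" x] by (simp add: mollifier_mass_def)

lemma mollifier_1: "mollifier 1 x z = radial 2 1 x z"
  by (simp add: mollifier_def)

lemma mollifier_mass_pos: "mollifier_mass TYPE('n::finite) > 0"
proof -
  let ?f = "radial 2 1 (0::real^'n)"
  have int: "integrable lborel ?f"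
    using integrable_mollifier[of 1 "0::real^'n"] by (simp add: mollifier_1[abs_def])
  have "mollifier_mass TYPE('n) \<noteq> 0"
  proof
    assume "mollifier_mass TYPE('n) = 0"
    then have ae: "AE x in lborel. ?f x = 0"
      using integral_nonneg_eq_0_iff_AE[OF int] by (simp add: mollifier_mass_def radial_nonneg)
    have pos: "?f x > 0" if "x \<in> ball 0 1" for x
      using that by (simp add: radial_def power_less_one_iff abs_square_less_1 flat_pos)
    from ae have "AE x in lborel. x \<notin> ball (0::real^'n) 1"
      by eventually_elim (metis pos less_irrefl)
    then have "emeasure lborel (ball (0::real^'n) 1) = 0"
      by (subst (asm) AE_iff_measurable[of "ball 0 1"]) auto
    then show False using unit_ball_vol_pos[of "real CARD('n)"] by (simp add: emeasure_ball)
  qed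
  moreover have "mollifier_mass TYPE('n) \<ge> 0"
    by (simp add: mollifier_mass_def radial_def flat_nonneg)
  ultimately show ?thesis by simp
qed

section \<open>Mollification of functions with bounded weak Laplacian\<close>

text \<open>The constant \<open>1000\<close> exceeds the bounds (at most \<open>8\<close> for the values and \<open>580\<close> for the partial
  derivatives) of the two families of bumps to which \<open>lap\<close> is applied.\<close>

locale bounded_weak_laplacian =
  fixes f :: "real^'n::finite \<Rightarrow> real" and B C :: real
  assumes meas [measurable]: "f \<in> borel_measurable borel"
    and bounded: "\<And>z. \<bar>f z\<bar> \<le> B"
    and C_nonneg: "C \<ge> 0"
    and lap: "\<And>v x R. v \<in> smooth_alg \<Longrightarrow> 0 < R \<Longrightarrow> R \<le> 2 \<Longrightarrow> (\<And>z. z \<notin> cball x R \<Longrightarrow> v z = 0) \<Longrightarrow>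
      (\<And>z. \<bar>v z\<bar> \<le> 1000) \<Longrightarrow> (\<And>z j. \<bar>partial j v z\<bar> \<le> 1000) \<Longrightarrow>
      \<bar>LINT z|lborel. f z * laplacian v z\<bar> \<le> C * R ^ CARD('n)"
begin

definition m :: "real \<Rightarrow> real^'n \<Rightarrow> real" where
  "m r x = (LINT z|lborel. f z * mollifier r x z)"

lemma B_nonneg: "B \<ge> 0"
  using bounded[of 0] by linarith

lemma integrable_f_mult:
  assumes [measurable]: "h \<in> borel_measurable borel" and "\<And>z. \<bar>h z\<bar> \<le> c * indicator (cball x r) z"
  shows "integrable lborel (\<lambda>z. f z * h z)"
proof (rule Bochner_Integration.integrable_bound[OF integrable_indicator_cball[of "B * c" x r]])
  have "\<bar>f z\<bar> * \<bar>h z\<bar> \<le> B * (c * indicator (cball x r) z)" for z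
    using assms(2) bounded B_nonneg by (intro mult_mono) auto
  then show "AE z in lborel. norm (f z * h z) \<le> norm (B * c * indicator (cball x r) z)"
    by (intro AE_I2) (metis abs_ge_self abs_mult mult.assoc order.trans real_norm_def)
qed simp

lemma integrable_f_mollifier: "r > 0 \<Longrightarrow> integrable lborel (\<lambda>z. f z * mollifier r x z)"
  by (rule integrable_f_mult[where c = "2 * inverse r ^ CARD('n)" and x = x and r = r])
    (auto simp: mollifier_nonneg mollifier_le)

lemma integrable_f_laplacian: "r > 0 \<Longrightarrow> integrable lborel (\<lambda>z. f z * laplacian (radial 0 r x) z)"
  by (rule integrable_f_mult[OF _ abs_laplacian_radial_le]) auto

text \<open>Differentiation under the integral turns the mollifier identity into a pairing of
  \<open>f\<close> with the Laplacian of a bump, which is the quantity that \<open>lap\<close>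
  controls.\<close>

lemma m_has_real_derivative:
  assumes "r > 0"
  shows "((\<lambda>r. m r x) has_real_derivative
    r * inverse r ^ CARD('n) / 2 * (LINT z|lborel. f z * laplacian (radial 0 r x) z)) (at r)"
proof -
  \<comment> \<open>For radii between r/2 and 2r the derivative is dominated by its worst values at
    these endpoints, supported in the ball of radius 2r.\<close>
  let ?g = "\<lambda>z. B * ((2 * r) * inverse (r / 2) ^ CARD('n) / 2 * ((4 * real CARD('n) + 144) / (r / 2)\<^sup>2 * indicator (cball x (2 * r)) z))"
  let ?f' = "\<lambda>t z. f z * (t * inverse t ^ CARD('n) / 2 * laplacian (radial 0 t x) z)"
  have "((\<lambda>r. LINT z|lborel. f z * mollifier r x z) has_real_derivative (LINT z|lborel. ?f' r z)) (at r)"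
  proof (rule has_real_derivative_integral[where a = "r / 2" and b = "2 * r" and g = ?g])
    fix t z assume t: "t \<in> {r / 2<..<2 * r}"
    then have t0: "t > 0" using assms by simp
    show "((\<lambda>t. f z * mollifier t x z) has_real_derivative ?f' t z) (at t)"
      by (rule DERIV_cmult[OF mollifier_has_real_derivative[OF t0]])
    have "\<bar>laplacian (radial 0 t x) z\<bar> \<le> (4 * real CARD('n) + 144) / t\<^sup>2 * indicator (cball x t) z"
      by (rule abs_laplacian_radial_le[OF t0])
    also have "\<dots> \<le> (4 * real CARD('n) + 144) / (r / 2)\<^sup>2 * indicator (cball x (2 * r)) z"
      using t assms by (intro mult_mono divide_left_mono power_mono mult_pos_pos zero_less_power)
        (auto split: split_indicator)
    finally have 1: "\<bar>laplacian (radial 0 t x) z\<bar> \<le> (4 * real CARD('n) + 144) / (r / 2)\<^sup>2 * indicator (cball x (2 * r)) z" .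
    have 2: "t * inverse t ^ CARD('n) / 2 \<le> (2 * r) * inverse (r / 2) ^ CARD('n) / 2"
      using t assms by (intro divide_right_mono mult_mono power_mono le_imp_inverse_le) auto
    have "\<bar>?f' t z\<bar> = \<bar>f z\<bar> * (t * inverse t ^ CARD('n) / 2 * \<bar>laplacian (radial 0 t x) z\<bar>)"
      using t0 by (simp add: abs_mult)
    also have "\<dots> \<le> ?g z"
      using 1 2 t0 assms bounded[of z] B_nonneg by (intro mult_mono) auto
    finally show "\<bar>?f' t z\<bar> \<le> ?g z" .
  next
    show "integrable lborel (\<lambda>z. f z * mollifier t x z)" if "t \<in> {r / 2<..<2 * r}" for t
      using that assms by (intro integrable_f_mollifier) auto
    show "integrable lborel ?g"
      by (intro integrable_mult_right integrable_indicator_cball)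
  qed (use assms in auto)
  also have "(LINT z|lborel. ?f' r z) = (LINT z|lborel. (r * inverse r ^ CARD('n) / 2) * (f z * laplacian (radial 0 r x) z))"
    by (intro Bochner_Integration.integral_cong) auto
  also have "\<dots> = r * inverse r ^ CARD('n) / 2 * (LINT z|lborel. f z * laplacian (radial 0 r x) z)"
    by (rule integral_mult_right_zero)
  finally show ?thesis unfolding m_def .
qed

lemma inverse_power_cancel: "r > 0 \<Longrightarrow> inverse r ^ CARD('n) * r ^ CARD('n) = (1::real)"
  by (simp add: power_mult_distrib[symmetric])

text \<open>The radial derivative is t^(-n) / 2 times the pairing with the Laplacian of t P_t. That
  function is bounded by 1 with partial derivatives bounded by 4, so \<open>lap\<close> gives C t^n
  and the powers of t cancel.\<close>

lemma m_lipschitz_radius: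
  assumes "0 < r" "r \<le> 1" "0 < s" "s \<le> 1"
  shows "\<bar>m r x - m s x\<bar> \<le> C * \<bar>r - s\<bar>"
proof -
  have "norm (m r x - m s x) \<le> C * norm (r - s)"
  proof (rule field_differentiable_bound[where S = "{0<..1}" and f = "\<lambda>r. m r x"])
    fix t :: real assume "t \<in> {0<..1}"
    then have t: "0 < t" "t \<le> 1" by auto
    show "((\<lambda>r. m r x) has_real_derivative
      t * inverse t ^ CARD('n) / 2 * (LINT z|lborel. f z * laplacian (radial 0 t x) z)) (at t within {0<..1})"
      using m_has_real_derivative[OF t(1)] by (rule has_field_derivative_at_within)
    let ?I = "LINT z|lborel. f z * laplacian (radial 0 t x) z"
    have sm: "(\<lambda>z. t * radial 0 t x z) \<in> smooth_alg"
      by (intro smooth_alg.mult smooth_alg.const radial_smooth_alg)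
    have "\<bar>LINT z|lborel. f z * laplacian (\<lambda>z. t * radial 0 t x z) z\<bar> \<le> C * t ^ CARD('n)"
    proof (rule lap[OF sm])
      show "t * radial 0 t x z = 0" if "z \<notin> cball x t" for z
        using that t by (simp add: radial_eq_0 dist_norm norm_minus_commute)
      show "\<bar>t * radial 0 t x z\<bar> \<le> 1000" for z
        using t mult_mono[of t 1 "\<bar>radial 0 t x z\<bar>" 1] abs_radial_le[of 0 t x z] by (simp add: abs_mult)
      show "\<bar>partial j (\<lambda>z. t * radial 0 t x z) z\<bar> \<le> 1000" for j z
      proof (cases "norm (z - x) < t")
        case True
        have "\<bar>(z - x) $ j\<bar> \<le> t" using component_le_norm_cart[of "z - x" j] True by linarith
        then have "\<bar>radial 2 t x z\<bar> * \<bar>(z - x) $ j\<bar> \<le> 2 * t"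
          using abs_radial_le[of 2 t x z] by (intro mult_mono) (auto simp: fact_numeral)
        then have "2 / t * (\<bar>radial 2 t x z\<bar> * \<bar>(z - x) $ j\<bar>) \<le> 2 / t * (2 * t)"
          using t by (intro mult_left_mono) auto
        moreover have "partial j (\<lambda>z. t * radial 0 t x z) z = - (2 / t * (radial 2 t x z * (z - x) $ j))"
          using t by (simp add: partial_cmult smooth_algD[OF radial_smooth_alg] partial_radial power2_eq_square eval_nat_numeral)
        ultimately show ?thesis using t by (simp add: abs_mult)
      next
        case False
        then show ?thesis using t
          by (simp add: partial_cmult smooth_algD[OF radial_smooth_alg] partial_radial radial_eq_0)
      qed
    qed (use t in auto)
    also have "(LINT z|lborel. f z * laplacian (\<lambda>z. t * radial 0 t x z) z) = (LINT z|lborel. t * (f z * laplacian (radial 0 t x) z))"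
      by (intro Bochner_Integration.integral_cong) (auto simp: laplacian_cmult[OF radial_smooth_alg])
    also have "\<dots> = t * ?I" by (rule integral_mult_right_zero)
    finally have "t * \<bar>?I\<bar> \<le> C * t ^ CARD('n)" using t by (simp add: abs_mult)
    then have "inverse t ^ CARD('n) / 2 * (t * \<bar>?I\<bar>) \<le> inverse t ^ CARD('n) / 2 * (C * t ^ CARD('n))"
      using t by (intro mult_left_mono) auto
    also have "\<dots> = C / 2" using inverse_power_cancel[OF t(1)] by (simp add: algebra_simps)
    also have "\<dots> \<le> C" using C_nonneg by simp
    finally show "norm (t * inverse t ^ CARD('n) / 2 * ?I) \<le> C" using t by (simp add: abs_mult mult_ac)
  qed (use assms in auto)
  then show ?thesis by simp
qed

text \<open>The factor \<open>r\<^sup>2 / \<delta>\<close> in \<open>v\<close> brings the partial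
  derivatives to order one. Dividing it out of the estimate from \<open>lap\<close> leaves the gain
  |x - y| / r^2.\<close>

lemma laplacian_radial_difference_le:
  assumes r: "0 < r" "r \<le> 1" and d: "x \<noteq> y" "norm (x - y) \<le> r"
  shows "\<bar>LINT z|lborel. f z * (laplacian (radial 0 r x) z - laplacian (radial 0 r y) z)\<bar>
    \<le> C * (2 * r) ^ CARD('n) * norm (x - y) / r\<^sup>2"
proof -
  define \<delta> where "\<delta> = norm (x - y)"
  have \<delta>: "0 < \<delta>" "\<delta> \<le> r" using d by (auto simp: \<delta>_def)
  define v where "v z = r\<^sup>2 / \<delta> * (radial 0 r x z - radial 0 r y z)" for z
  let ?I = "LINT z|lborel. f z * (laplacian (radial 0 r x) z - laplacian (radial 0 r y) z)"
  have smd: "(\<lambda>z. radial 0 r x z - radial 0 r y z) \<in> smooth_alg"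
    by (intro smooth_alg_diff radial_smooth_alg)
  have sm: "v \<in> smooth_alg" unfolding v_def[abs_def]
    by (intro smooth_alg.mult smooth_alg.const smd)
  have "\<bar>LINT z|lborel. f z * laplacian v z\<bar> \<le> C * (2 * r) ^ CARD('n)"
  proof (rule lap[OF sm])
    \<comment> \<open>Both bumps live in the ball of radius 2r around x, and r <= 1; this is why
      \<open>lap\<close> is required for radii up to 2.\<close>
    show "v z = 0" if "z \<notin> cball x (2 * r)" for z
    proof -
      have gt: "norm (z - x) > 2 * r" using that by (simp add: dist_norm norm_minus_commute)
      have "norm (z - y) \<ge> r"
        by (rule radial_cases[OF r(1) d(2), of z]) (use gt r in auto)
      with gt show ?thesis using r by (simp add: v_def radial_eq_0)
    qed
    show "\<bar>v z\<bar> \<le> 1000" for z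
    proof -
      have "\<bar>v z\<bar> = r\<^sup>2 / \<delta> * \<bar>radial 0 r x z - radial 0 r y z\<bar>" using \<delta> by (simp add: v_def abs_mult)
      also have "\<dots> \<le> r\<^sup>2 / \<delta> * (2 * (4 * \<delta> / r))"
        using radial_diff_le[OF r(1) d(2), of 0 z] \<delta> by (intro mult_left_mono) (auto simp: \<delta>_def fact_numeral)
      also have "\<dots> = 8 * r" using \<delta> r by (simp add: power2_eq_square)
      finally show ?thesis using r by simp
    qed
    show "\<bar>partial j v z\<bar> \<le> 1000" for j z
    proof -
      have "partial j v z = r\<^sup>2 / \<delta> * (partial j (radial 0 r x) z - partial j (radial 0 r y) z)"
        unfolding v_def[abs_def]
        by (simp only: partial_cmult[OF smooth_algD(1)[OF smd]]
            partial_diff[OF smooth_algD(1)[OF radial_smooth_alg] smooth_algD(1)[OF radial_smooth_alg]])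
      also have "\<dots> = - (2 / \<delta>) * (radial 2 r x z * (z - x) $ j - radial 2 r y z * (z - y) $ j)"
        using r \<delta> by (simp add: partial_radial eval_nat_numeral field_simps)
      moreover have abs_c: "\<bar>- (2 / \<delta>) * a\<bar> = 2 / \<delta> * \<bar>a\<bar>" for a using \<delta> by (simp add: abs_mult)
      ultimately have "\<bar>partial j v z\<bar> = 2 / \<delta> * \<bar>radial 2 r x z * (z - x) $ j - radial 2 r y z * (z - y) $ j\<bar>"
        using abs_c by (simp only:)
      \<comment> \<open>290 is the constant of \<open>radial_component_diff_le\<close> at k =
        2.\<close>
      also have "\<dots> \<le> 2 / \<delta> * (290 * \<delta>)"
        using radial_component_diff_le[OF r(1) d(2), of 2 z j] \<delta>
        by (intro mult_left_mono) (auto simp: \<delta>_def fact_numeral)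
      also have "\<dots> \<le> 1000" using \<delta> by simp
      finally show ?thesis .
    qed
  qed (use r in auto)
  also have "(LINT z|lborel. f z * laplacian v z) =
      (LINT z|lborel. r\<^sup>2 / \<delta> * (f z * (laplacian (radial 0 r x) z - laplacian (radial 0 r y) z)))"
    unfolding v_def[abs_def]
    by (intro Bochner_Integration.integral_cong) (simp_all only: laplacian_cmult[OF smd] laplacian_diff[OF radial_smooth_alg radial_smooth_alg] mult.left_commute)
  also have "\<dots> = r\<^sup>2 / \<delta> * ?I" by (rule integral_mult_right_zero)
  finally have "r\<^sup>2 / \<delta> * \<bar>?I\<bar> \<le> C * (2 * r) ^ CARD('n)" using \<delta> by (simp add: abs_mult)
  then have "\<delta> / r\<^sup>2 * (r\<^sup>2 / \<delta> * \<bar>?I\<bar>) \<le> \<delta> / r\<^sup>2 * (C * (2 * r) ^ CARD('n))"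
    using \<delta> by (intro mult_left_mono) auto
  moreover have "\<delta> / r\<^sup>2 * (r\<^sup>2 / \<delta> * \<bar>?I\<bar>) = \<bar>?I\<bar>" using \<delta> r by simp
  ultimately show ?thesis by (simp add: \<delta>_def mult_ac)
qed

text \<open>The factor r^(1-n) from the derivative meets (2r)^n |x - y| / r^2 from the previous
  estimate; 2^n is the price of the doubled support radius.\<close>

lemma m_difference_derivative:
  assumes r: "0 < r" "r \<le> 1" and d: "x \<noteq> y" "norm (x - y) \<le> r"
  obtains D where "((\<lambda>r. m r x - m r y) has_real_derivative D) (at r)"
    "\<bar>D\<bar> \<le> C * 2 ^ CARD('n) * norm (x - y) / r"
proof
  let ?I = "LINT z|lborel. f z * (laplacian (radial 0 r x) z - laplacian (radial 0 r y) z)"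
  have "?I = (LINT z|lborel. f z * laplacian (radial 0 r x) z) - (LINT z|lborel. f z * laplacian (radial 0 r y) z)"
    using r by (simp add: right_diff_distrib integrable_f_laplacian)
  then show "((\<lambda>r. m r x - m r y) has_real_derivative (r * inverse r ^ CARD('n) / 2 * ?I)) (at r)"
    using DERIV_diff[OF m_has_real_derivative[OF r(1), of x] m_has_real_derivative[OF r(1), of y]]
    by (simp add: right_diff_distrib)
  have half: "a / 2 \<le> a" if "0 \<le> a" for a :: real using that by simp
  have "\<bar>r * inverse r ^ CARD('n) / 2 * ?I\<bar> = r * inverse r ^ CARD('n) / 2 * \<bar>?I\<bar>" using r by (simp add: abs_mult)
  also have "\<dots> \<le> r * inverse r ^ CARD('n) / 2 * (C * (2 * r) ^ CARD('n) * norm (x - y) / r\<^sup>2)"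
    using laplacian_radial_difference_le[OF assms] r by (intro mult_left_mono) auto
  also have "\<dots> = (inverse r ^ CARD('n) * r ^ CARD('n)) * (C * 2 ^ CARD('n) * norm (x - y) / r) / 2"
    using r by (simp add: power_mult_distrib power2_eq_square field_simps)
  also have "\<dots> = C * 2 ^ CARD('n) * norm (x - y) / r / 2"
    using r by (simp add: inverse_power_cancel)
  also have "\<dots> \<le> C * 2 ^ CARD('n) * norm (x - y) / r"
    by (rule half) (use r C_nonneg in auto)
  finally show "\<bar>r * inverse r ^ CARD('n) / 2 * ?I\<bar> \<le> C * 2 ^ CARD('n) * norm (x - y) / r" .
qed

text \<open>The integration over r is done by monotonicity: with D(r) = m r x - m r y, the function
  D(r) + K ln r increases and D(r) - K ln r decreases on [|x - y|, 1].\<close>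

lemma m_difference_log:
  assumes d: "x \<noteq> y" "norm (x - y) \<le> 1"
  shows "\<bar>m (norm (x - y)) x - m (norm (x - y)) y\<bar>
    \<le> \<bar>m 1 x - m 1 y\<bar> + C * 2 ^ CARD('n) * norm (x - y) * ln (inverse (norm (x - y)))"
proof -
  define \<delta> where "\<delta> = norm (x - y)"
  define K where "K = C * 2 ^ CARD('n) * \<delta>"
  have \<delta>: "0 < \<delta>" "\<delta> \<le> 1" using d by (auto simp: \<delta>_def)
  let ?D = "\<lambda>r. m r x - m r y"
  have der: "\<exists>D. (?D has_real_derivative D) (at r) \<and> \<bar>D\<bar> \<le> K / r" if "\<delta> \<le> r" "r \<le> 1" for r
    using m_difference_derivative[of r x y] that \<delta> d by (auto simp: \<delta>_def K_def)
  have "?D \<delta> + K * ln \<delta> \<le> ?D 1 + K * ln 1"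
  proof (rule DERIV_nonneg_imp_nondecreasing[OF \<delta>(2)])
    fix r assume r: "\<delta> \<le> r" "r \<le> 1"
    from der[OF this] obtain D where D: "(?D has_real_derivative D) (at r)" "\<bar>D\<bar> \<le> K / r" by blast
    have "((\<lambda>r. ?D r + K * ln r) has_real_derivative D + K * (1 / r)) (at r)"
      using r \<delta> by (intro DERIV_add D DERIV_cmult DERIV_ln_divide) auto
    moreover have "D + K * (1 / r) \<ge> 0" using D(2) by simp
    ultimately show "\<exists>y. ((\<lambda>r. ?D r + K * ln r) has_real_derivative y) (at r) \<and> 0 \<le> y" by blast
  qed
  moreover have "?D \<delta> - K * ln \<delta> \<ge> ?D 1 - K * ln 1"
  proof (rule DERIV_nonpos_imp_nonincreasing[OF \<delta>(2)])
    fix r assume r: "\<delta> \<le> r" "r \<le> 1"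
    from der[OF this] obtain D where D: "(?D has_real_derivative D) (at r)" "\<bar>D\<bar> \<le> K / r" by blast
    have "((\<lambda>r. ?D r - K * ln r) has_real_derivative D - K * (1 / r)) (at r)"
      using r \<delta> by (intro DERIV_diff D DERIV_cmult DERIV_ln_divide) auto
    moreover have "D - K * (1 / r) \<le> 0" using D(2) by simp
    ultimately show "\<exists>y. ((\<lambda>r. ?D r - K * ln r) has_real_derivative y) (at r) \<and> y \<le> 0" by blast
  qed
  ultimately have "\<bar>?D \<delta>\<bar> \<le> \<bar>?D 1\<bar> - K * ln \<delta>" by simp
  then show ?thesis using \<delta> by (simp add: \<delta>_def[symmetric] K_def ln_inverse)
qed

text \<open>At radius 1 the mollifier itself is Lipschitz in its centre, with constant 36 * 4 = 144,
  and the difference of two is supported in a ball of radius 2.\<close>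

lemma m_1_difference:
  assumes d: "norm (x - y) \<le> 1"
  shows "\<bar>m 1 x - m 1 y\<bar> \<le> B * (144 * measure lborel (cball (0::real^'n) 2)) * norm (x - y)"
proof -
  let ?h = "\<lambda>z. mollifier 1 x z - mollifier 1 y z"
  have h: "\<bar>?h z\<bar> \<le> 144 * norm (x - y) * indicator (cball x 2) z" for z
  proof (rule radial_cases[OF zero_less_one d, of z])
    assume "1 \<le> norm (z - x)" "1 \<le> norm (z - y)"
    then show ?thesis by (simp add: mollifier_1 radial_eq_0)
  next
    assume "norm (z - x) \<le> 2 * 1"
    then have "z \<in> cball x 2" by (simp add: dist_norm norm_minus_commute)
    then show ?thesis using radial_diff_le[OF zero_less_one d, of 2 z] by (simp add: mollifier_1 fact_numeral)
  qed
  have "m 1 x - m 1 y = (LINT z|lborel. f z * ?h z)"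
    by (simp add: m_def right_diff_distrib integrable_f_mollifier)
  also have "\<bar>\<dots>\<bar> \<le> (LINT z|lborel. (B * (144 * norm (x - y))) * indicator (cball x 2) z)"
  proof (rule order.trans[OF integral_abs_bound integral_mono])
    show "integrable lborel (\<lambda>z. \<bar>f z * ?h z\<bar>)"
      by (intro integrable_abs integrable_f_mult[OF _ h]) auto
    show "\<bar>f z * ?h z\<bar> \<le> (B * (144 * norm (x - y))) * indicator (cball x 2) z" for z
      using mult_mono[OF bounded h B_nonneg abs_ge_zero, of z z] by (simp add: abs_mult mult.assoc)
  qed (rule integrable_indicator_cball)
  also have "\<dots> = B * (144 * norm (x - y)) * measure lborel (cball x 2)" by simp
  also have "measure lborel (cball x 2) = measure lborel (cball (0::real^'n) 2)"
    by (simp add: content_cball)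
  finally show ?thesis by (simp add: mult_ac)
qed

end

section \<open>The limit of vanishing radius and the log-Lipschitz representative\<close>

lemma flat_measurable [measurable]: "flat k \<in> borel_measurable borel"
  by (rule borel_measurable_continuous_onI[OF continuous_flat])

lemma mollifier_commute: "mollifier r x z = mollifier r z x"
  by (simp add: mollifier_def radial_def norm_minus_commute)

text \<open>2C is the cost of replacing the limit by the mollification at x and at y, the term with
  B is the difference at radius 1, and their factor 2 comes from 1 <= 2 ln(1/|x - y|). The term with
  2^n belongs to the logarithm proper, and the division normalises the mollifier.\<close>

definition log_lipschitz_const :: "'n::finite itself \<Rightarrow> real \<Rightarrow> real \<Rightarrow> real" where
  "log_lipschitz_const _ B C =
     ((2 * C + B * (144 * measure lborel (cball (0::real^'n) 2))) * 2 + C * 2 ^ CARD('n)) / mollifier_mass TYPE('n)"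

context bounded_weak_laplacian
begin

lemma m_measurable: "m r \<in> borel_measurable borel"
proof -
  have "(\<lambda>x. LINT z|lborel. f z * mollifier r x z) \<in> borel_measurable borel"
    unfolding mollifier_def radial_def by measurable
  then show ?thesis by (simp add: m_def[abs_def])
qed

lemma abs_m_le:
  assumes "r > 0"
  shows "\<bar>m r x\<bar> \<le> B * mollifier_mass TYPE('n)"
proof -
  have "\<bar>m r x\<bar> \<le> (LINT z|lborel. B * mollifier r x z)"
    unfolding m_def
  proof (rule order.trans[OF integral_abs_bound integral_mono])
    show "\<bar>f z * mollifier r x z\<bar> \<le> B * mollifier r x z" for z
      using mult_right_mono[OF bounded mollifier_nonneg[OF assms]] mollifier_nonneg[OF assms, of x z]
      by (simp add: abs_mult)
  qed (use assms in \<open>auto intro: integrable_f_mollifier integrable_mollifier\<close>)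
  also have "\<dots> = B * mollifier_mass TYPE('n)"
    using integral_mollifier[OF assms, of x] by simp
  finally show ?thesis .
qed

text \<open>Fubini together with the symmetry of the mollifier in x and z moves the averaging from
  \<open>f\<close> to the continuous function \<phi>.\<close>

lemma integral_m_mult:
  assumes r: "r > 0" and cont: "continuous_on UNIV \<phi>" and K: "compact K" "\<And>x. x \<notin> K \<Longrightarrow> \<phi> x = 0"
  shows "(LINT x|lborel. m r x * \<phi> x) = (LINT z|lborel. f z * (LINT w|lborel. radial 2 1 0 w * \<phi> (z + r *\<^sub>R w)))"
proof -
  have [measurable]: "\<phi> \<in> borel_measurable borel"
    by (rule borel_measurable_continuous_onI[OF cont])
  obtain S where S: "S > 0" "\<And>x. \<bar>\<phi> x\<bar> \<le> S"
    using continuous_compact_support_bounded[OF cont K] by metis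
  obtain R where R: "\<And>x. x \<in> K \<Longrightarrow> norm x \<le> R"
    using compact_imp_bounded[OF K(1)] by (auto simp: bounded_iff)
  let ?F = "\<lambda>x z. f z * mollifier r x z * \<phi> x"
  let ?A = "cball (0::real^'n) R" and ?A' = "cball (0::real^'n) (R + r)"
  let ?b = "B * (2 * inverse r ^ CARD('n)) * S"
  \<comment> \<open>A multiple of the indicator of a product of two balls dominates the integrand,
    which makes it integrable on the product space.\<close>
  have bound: "\<bar>?F x z\<bar> \<le> ?b * indicator (?A \<times> ?A') (x, z)" for x z
  proof (cases "x \<in> K \<and> norm (z - x) < r")
    case True
    then have "norm x \<le> R" "norm z \<le> R + r" using R[of x] norm_triangle_sub[of z x] by auto
    moreover have "mollifier r x z \<le> 2 * inverse r ^ CARD('n)"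
      using mollifier_le[OF r, of x z] True by (simp add: dist_norm norm_minus_commute)
    then have "\<bar>f z\<bar> * mollifier r x z * \<bar>\<phi> x\<bar> \<le> ?b"
      using bounded[of z] mollifier_nonneg[OF r, of x z] S B_nonneg r by (intro mult_mono) auto
    ultimately show ?thesis using mollifier_nonneg[OF r, of x z] by (simp add: abs_mult)
  next
    case False
    then have "?F x z = 0" using K(2) r by (auto simp: mollifier_def radial_eq_0)
    moreover have "0 \<le> ?b * indicator (?A \<times> ?A') (x, z)"
      using B_nonneg S r by simp
    ultimately show ?thesis by (simp only: abs_zero)
  qed
  have int: "integrable (lborel \<Otimes>\<^sub>M lborel) (\<lambda>(x, z). ?F x z)"
  proof (rule Bochner_Integration.integrable_bound)
    have "emeasure (lborel \<Otimes>\<^sub>M lborel) (?A \<times> ?A') < \<infinity>"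
      using emeasure_bounded_finite[OF bounded_cball, of "0::real^'n" R] emeasure_bounded_finite[OF bounded_cball, of "0::real^'n" "R + r"]
      by (simp add: lborel.emeasure_pair_measure_Times ennreal_mult_less_top)
    then show "integrable (lborel \<Otimes>\<^sub>M lborel) (\<lambda>p. ?b * indicator (?A \<times> ?A') p)"
      by (intro integrable_mult_right integrable_real_indicator) auto
    show "(\<lambda>(x, z). ?F x z) \<in> borel_measurable (lborel \<Otimes>\<^sub>M lborel)"
      unfolding mollifier_def radial_def by measurable
    show "AE p in lborel \<Otimes>\<^sub>M lborel. norm (case p of (x, z) \<Rightarrow> ?F x z) \<le> norm (?b * indicator (?A \<times> ?A') p)"
      using bound by (intro AE_I2) (auto intro: order.trans[OF _ abs_ge_self])
  qed
  have "(LINT x|lborel. m r x * \<phi> x) = (LINT x|lborel. LINT z|lborel. ?F x z)"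
    by (simp add: m_def)
  also have "\<dots> = (LINT z|lborel. LINT x|lborel. ?F x z)"
    using lborel_pair.Fubini_integral[OF int] by simp
  also have "\<dots> = (LINT z|lborel. f z * (LINT x|lborel. mollifier r z x * \<phi> x))"
    by (intro Bochner_Integration.integral_cong refl)
      (simp add: mult.assoc mollifier_commute[of r _ z for z])
  also have "\<dots> = (LINT z|lborel. f z * (LINT w|lborel. radial 2 1 0 w * \<phi> (z + r *\<^sub>R w)))"
    by (simp add: integral_mollifier_mult[OF r])
  finally show ?thesis .
qed

lemma integrable_radial: "integrable lborel (radial 2 1 (0::real^'n))"
  using integrable_mollifier[of 1 "0::real^'n"] by (simp add: mollifier_1[abs_def])

text \<open>Once the averaging sits on \<phi>, continuity gives pointwise convergence of the
  averages to the mass times \<phi>. Dominated convergence is used for the inner and for the outer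
  integral.\<close>

lemma integral_m_mult_tendsto:
  assumes cont: "continuous_on UNIV \<phi>" and K: "compact K" "\<And>x. x \<notin> K \<Longrightarrow> \<phi> x = 0"
    and X: "\<And>k. 0 < X k" "\<And>k. X k \<le> 1" "X \<longlonglongrightarrow> 0"
  shows "(\<lambda>k::nat. LINT x|lborel. m (X k) x * \<phi> x) \<longlonglongrightarrow> mollifier_mass TYPE('n) * (LINT z|lborel. f z * \<phi> z)"
proof -
  have [measurable]: "\<phi> \<in> borel_measurable borel"
    by (rule borel_measurable_continuous_onI[OF cont])
  have [measurable]: "radial 2 1 (0::real^'n) \<in> borel_measurable borel"
    by (rule borel_measurable_continuous_onI[OF smooth_alg_continuous[OF radial_smooth_alg]])
  obtain S where S: "S > 0" "\<And>x. \<bar>\<phi> x\<bar> \<le> S"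
    using continuous_compact_support_bounded[OF cont K] by metis
  obtain R where R: "\<And>x. x \<in> K \<Longrightarrow> norm x \<le> R"
    using compact_imp_bounded[OF K(1)] by (auto simp: bounded_iff)
  let ?e = "radial 2 1 (0::real^'n)" and ?c = "mollifier_mass TYPE('n)"
  let ?a = "\<lambda>r z. LINT w|lborel. ?e w * \<phi> (z + r *\<^sub>R w)"
  have ee: "norm (?e w * \<phi> z) \<le> S * ?e w" for w z
    using mult_left_mono[OF S(2) radial_nonneg[of 2 1 0 w], of z] radial_nonneg[of 2 1 0 w]
    by (simp add: abs_mult mult.commute)
  have lim: "(\<lambda>k. ?a (X k) z) \<longlonglongrightarrow> ?c * \<phi> z" for z
  proof -
    have "(\<lambda>k. ?a (X k) z) \<longlonglongrightarrow> (LINT w|lborel. ?e w * \<phi> z)"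
    proof (rule integral_dominated_convergence[where w = "\<lambda>w. S * ?e w"])
      show "AE w in lborel. (\<lambda>k. ?e w * \<phi> (z + X k *\<^sub>R w)) \<longlonglongrightarrow> ?e w * \<phi> z"
      proof (intro AE_I2 tendsto_mult tendsto_const)
        fix w
        have "(\<lambda>k. z + X k *\<^sub>R w) \<longlonglongrightarrow> z + 0 *\<^sub>R w" by (intro tendsto_intros X)
        moreover have "isCont \<phi> z" using cont by (simp add: continuous_on_eq_continuous_at)
        ultimately show "(\<lambda>k. \<phi> (z + X k *\<^sub>R w)) \<longlonglongrightarrow> \<phi> z"
          by (intro isCont_tendsto_compose[of z \<phi>]) simp_all
      qed
    qed (use ee integrable_radial in auto)
    then show ?thesis by (simp add: mollifier_mass_def)
  qed
  \<comment> \<open>Since X k <= 1 and the profile is supported in the unit ball, all averages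
    vanish outside one ball of radius R + 1.\<close>
  have bd: "\<bar>?a (X k) z\<bar> \<le> S * ?c * indicator (cball 0 (R + 1)) z" for k z
  proof (cases "norm z \<le> R + 1")
    case True
    have "\<bar>?a (X k) z\<bar> \<le> (LINT w|lborel. S * ?e w)"
    proof (rule order.trans[OF integral_abs_bound integral_mono])
      show "integrable lborel (\<lambda>w. \<bar>?e w * \<phi> (z + X k *\<^sub>R w)\<bar>)"
      proof (rule integrable_abs, rule Bochner_Integration.integrable_bound[where f = "\<lambda>w. S * ?e w"])
        show "AE w in lborel. norm (?e w * \<phi> (z + X k *\<^sub>R w)) \<le> norm (S * ?e w)"
          using ee by (intro AE_I2) (auto intro: order.trans[OF _ abs_ge_self])
      qed (use integrable_radial in auto)
    qed (use ee integrable_radial in auto)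
    then show ?thesis using True by (simp add: mollifier_mass_def)
  next
    case False
    have "?e w * \<phi> (z + X k *\<^sub>R w) = 0" for w
    proof (cases "norm w \<ge> 1")
      case True
      then show ?thesis by (simp add: radial_eq_0)
    next
      case w: False
      have "norm (X k *\<^sub>R w) \<le> 1" using w X(1,2)[of k] by (simp add: mult_le_one)
      then have "norm (z + X k *\<^sub>R w) > R" using False norm_diff_ineq[of z "X k *\<^sub>R w"] by linarith
      then show ?thesis using R K(2) by (metis linorder_not_less mult_zero_right)
    qed
    then have "?a (X k) z = 0" by (simp only: Bochner_Integration.integral_zero)
    moreover have "0 \<le> S * ?c * indicator (cball 0 (R + 1)) z"
      using S mollifier_mass_pos[where 'n = 'n] by simp
    ultimately show ?thesis by (simp only: abs_zero)
  qed
  have "(\<lambda>k. LINT z|lborel. f z * ?a (X k) z) \<longlonglongrightarrow> (LINT z|lborel. f z * (?c * \<phi> z))"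
  proof (rule integral_dominated_convergence[where w = "\<lambda>z. (B * (S * ?c)) * indicator (cball 0 (R + 1)) z"])
    show "AE z in lborel. (\<lambda>k. f z * ?a (X k) z) \<longlonglongrightarrow> f z * (?c * \<phi> z)"
      by (intro AE_I2 tendsto_mult tendsto_const lim)
    show "AE z in lborel. norm (f z * ?a (X k) z) \<le> (B * (S * ?c)) * indicator (cball 0 (R + 1)) z" for k
    proof (rule AE_I2)
      fix z
      show "norm (f z * ?a (X k) z) \<le> (B * (S * ?c)) * indicator (cball 0 (R + 1)) z"
        using mult_mono[OF bounded[of z] bd[of z k] B_nonneg abs_ge_zero] by (simp add: abs_mult mult.assoc)
    qed
    show "(\<lambda>z. f z * ?a (X k) z) \<in> borel_measurable lborel" for k by measurable
    show "integrable lborel (\<lambda>z::real^'n. (B * (S * ?c)) * indicator (cball 0 (R + 1)) z)"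
      by (rule integrable_indicator_cball)
  qed measurable
  also have "(LINT z|lborel. f z * (?c * \<phi> z)) = (LINT z|lborel. ?c * (f z * \<phi> z))"
    by (simp add: mult.left_commute)
  also have "\<dots> = ?c * (LINT z|lborel. f z * \<phi> z)" by (rule integral_mult_right_zero)
  finally show ?thesis by (simp add: integral_m_mult[OF X(1) cont K])
qed

text \<open>The Lipschitz bound in the radius makes the mollifications Cauchy at every point, not
  only almost everywhere; letting one radius tend to 0 gives the rate C r.\<close>

lemma m_limit:
  obtains L where "\<And>r x. 0 < r \<Longrightarrow> r \<le> 1 \<Longrightarrow> \<bar>m r x - L x\<bar> \<le> C * r"
proof -
  have "convergent (\<lambda>k. m (inverse (real (Suc k))) x)" for x
  proof (rule Cauchy_convergent, rule metric_CauchyI)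
    fix e :: real assume "e > 0"
    \<comment> \<open>The denominator is C + 1 because C may be 0.\<close>
    obtain K where K: "inverse (real (Suc K)) < e / (C + 1)"
      using reals_Archimedean[of "e / (C + 1)"] \<open>e > 0\<close> C_nonneg by auto
    have "dist (m (inverse (real (Suc i))) x) (m (inverse (real (Suc j))) x) < e" if "i \<ge> K" "j \<ge> K" for i j
    proof -
      have i: "0 < inverse (real (Suc k))" "inverse (real (Suc k)) \<le> 1" for k by (auto simp: field_simps)
      have le: "inverse (real (Suc k)) \<le> inverse (real (Suc K))" if "k \<ge> K" for k using that by (auto simp: field_simps)
      have "\<bar>inverse (real (Suc i)) - inverse (real (Suc j))\<bar> \<le> inverse (real (Suc K))"
        using le[OF that(1)] le[OF that(2)] i(1)[of i] i(1)[of j] by linarith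
      then have "C * \<bar>inverse (real (Suc i)) - inverse (real (Suc j))\<bar> \<le> (C + 1) * inverse (real (Suc K))"
        using C_nonneg by (intro mult_mono) auto
      also have "\<dots> < e" using K C_nonneg by (simp add: field_simps)
      finally show ?thesis using m_lipschitz_radius[OF i(1)[of i] i(2)[of i] i(1)[of j] i(2)[of j], of x] by (simp add: dist_real_def)
    qed
    then show "\<exists>M. \<forall>i\<ge>M. \<forall>j\<ge>M. dist (m (inverse (real (Suc i))) x) (m (inverse (real (Suc j))) x) < e" by blast
  qed
  then obtain L where L: "\<And>x. (\<lambda>k. m (inverse (real (Suc k))) x) \<longlonglongrightarrow> L x"
    unfolding convergent_def by metis
  have "\<bar>m r x - L x\<bar> \<le> C * r" if r: "0 < r" "r \<le> 1" for r x
  proof (rule LIMSEQ_le)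
    show "(\<lambda>k. \<bar>m r x - m (inverse (real (Suc k))) x\<bar>) \<longlonglongrightarrow> \<bar>m r x - L x\<bar>"
      by (intro tendsto_intros L)
    show "(\<lambda>k. C * \<bar>r - inverse (real (Suc k))\<bar>) \<longlonglongrightarrow> C * r"
      using tendsto_mult[OF tendsto_const tendsto_rabs[OF tendsto_diff[OF tendsto_const LIMSEQ_inverse_real_of_nat]], of C r] r
      by simp
    show "\<exists>N. \<forall>n\<ge>N. \<bar>m r x - m (inverse (real (Suc n))) x\<bar> \<le> C * \<bar>r - inverse (real (Suc n))\<bar>"
      by (intro exI[of _ 0] allI impI m_lipschitz_radius r) (auto simp: field_simps)
  qed
  then show ?thesis by (rule that)
qed

text \<open>The representative is the pointwise limit of the mollifications divided by their
  mass.\<close>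

lemma log_lipschitz_representative:
  obtains g where "AE x in lborel. g x = f x" "\<And>x. \<bar>g x\<bar> \<le> B"
    "\<And>x y. norm (x - y) \<le> 1 / 2 \<Longrightarrow>
       \<bar>g x - g y\<bar> \<le> log_lipschitz_const TYPE('n) B C * norm (x - y) * ln (inverse (norm (x - y)))"
proof -
  let ?c = "mollifier_mass TYPE('n)"
  have c: "?c > 0" by (rule mollifier_mass_pos)
  obtain L where L: "\<And>r x. 0 < r \<Longrightarrow> r \<le> 1 \<Longrightarrow> \<bar>m r x - L x\<bar> \<le> C * r"
    by (rule m_limit) blast
  define X where "X k = inverse (real (Suc k))" for k
  have X: "0 < X k" "X k \<le> 1" "X \<longlonglongrightarrow> 0" for k
    using LIMSEQ_inverse_real_of_nat by (auto simp: X_def[abs_def] field_simps)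
  have lim: "(\<lambda>k. m (X k) x) \<longlonglongrightarrow> L x" for x
  proof (rule LIM_zero_cancel, rule Lim_null_comparison)
    show "\<forall>\<^sub>F k in sequentially. norm (m (X k) x - L x) \<le> C * X k"
      using L X by (auto intro!: always_eventually)
    show "(\<lambda>k. C * X k) \<longlonglongrightarrow> 0" using tendsto_mult_right_zero[OF X(3)] by simp
  qed
  have L_meas [measurable]: "L \<in> borel_measurable borel"
    by (rule borel_measurable_LIMSEQ_real[OF lim m_measurable])
  have L_bound: "\<bar>L x\<bar> \<le> B * ?c" for x
    by (rule LIMSEQ_le_const2[OF tendsto_rabs[OF lim]]) (use abs_m_le X in blast)
  show ?thesis
  proof (rule that[of "\<lambda>x. L x / ?c"])
    show "\<bar>L x / ?c\<bar> \<le> B" for x using L_bound[of x] c by (simp add: abs_divide divide_le_eq)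
    \<comment> \<open>The pairing of the mollifications with \<phi> has two limits: one through
      pointwise convergence to \<open>L\<close>, one through averaging \<phi>. Equating them shows
      that \<open>L\<close> and mass times \<open>f\<close> act alike on test functions.\<close>
    have orth: "(LINT x|lebesgue_on UNIV. (L x - ?c * f x) * \<phi> x) = 0" if \<phi>: "\<phi> \<in> test_functions UNIV" for \<phi>
    proof -
      obtain K where K: "compact K" "\<And>x. x \<notin> K \<Longrightarrow> \<phi> x = 0" and cont: "continuous_on UNIV \<phi>"
        using test_functionsD[OF \<phi>] by metis
      have [measurable]: "\<phi> \<in> borel_measurable borel"
        by (rule borel_measurable_continuous_onI[OF cont])
      have int: "integrable lborel \<phi>" by (rule integrable_continuous_compact_support[OF cont K])
      have int_mult: "integrable lborel (\<lambda>x. h x * \<phi> x)"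
        if [measurable]: "h \<in> borel_measurable borel" and b: "\<And>x. \<bar>h x\<bar> \<le> b" for h b
      proof (rule Bochner_Integration.integrable_bound[where f = "\<lambda>x. b * \<bar>\<phi> x\<bar>"])
        show "AE x in lborel. norm (h x * \<phi> x) \<le> norm (b * \<bar>\<phi> x\<bar>)"
          using b by (intro AE_I2) (auto simp: abs_mult intro!: mult_mono order.trans[OF b])
      qed (use int in auto)
      have "(\<lambda>k. LINT x|lborel. m (X k) x * \<phi> x) \<longlonglongrightarrow> (LINT x|lborel. L x * \<phi> x)"
      proof (rule integral_dominated_convergence[where w = "\<lambda>x. B * ?c * \<bar>\<phi> x\<bar>"])
        show "AE x in lborel. (\<lambda>k. m (X k) x * \<phi> x) \<longlonglongrightarrow> L x * \<phi> x"
          by (intro AE_I2 tendsto_mult tendsto_const lim)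
        show "AE x in lborel. norm (m (X k) x * \<phi> x) \<le> B * ?c * \<bar>\<phi> x\<bar>" for k
          using abs_m_le[OF X(1)] by (intro AE_I2) (auto simp: abs_mult intro!: mult_right_mono)
        show "(\<lambda>x. m (X k) x * \<phi> x) \<in> borel_measurable lborel" for k using m_measurable by measurable
      qed (use int in auto)
      then have "(LINT x|lborel. L x * \<phi> x) = ?c * (LINT z|lborel. f z * \<phi> z)"
        using integral_m_mult_tendsto[OF cont K X] by (rule LIMSEQ_unique)
      then have "(LINT x|lborel. (L x - ?c * f x) * \<phi> x) = 0"
        using int_mult[OF L_meas L_bound] int_mult[OF meas bounded] by (simp add: left_diff_distrib mult.assoc)
      moreover have "(LINT x|lebesgue. (L x - ?c * f x) * \<phi> x) = (LINT x|lborel. (L x - ?c * f x) * \<phi> x)"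
        by (rule integral_completion) measurable
      ultimately show ?thesis by (simp add: lebesgue_on_UNIV_eq)
    qed
    have "(\<lambda>x. L x - ?c * f x) \<in> L1_loc UNIV"
      unfolding L1_loc_def
    proof safe
      fix K :: "(real^'n) set" assume K: "compact K"
      have b: "\<bar>L x - ?c * f x\<bar> \<le> 2 * (B * ?c)" for x
      proof -
        have "\<bar>?c * f x\<bar> \<le> B * ?c"
          using mult_left_mono[OF bounded[of x], of ?c] c by (simp add: abs_mult mult.commute)
        then show ?thesis using L_bound[of x] by linarith
      qed
      have "integrable lborel (\<lambda>x. indicator K x *\<^sub>R (L x - ?c * f x))"
      proof (rule integrableI_bounded_set_indicator[where B = "2 * (B * ?c)"])
        show "emeasure lborel K < \<infinity>" using emeasure_compact_finite[OF K] .
        show "K \<in> sets lborel" using K by (simp add: borel_compact)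
      qed (use b in auto)
      then have "integrable lebesgue (\<lambda>x. indicator K x *\<^sub>R (L x - ?c * f x))"
        using K by (subst integrable_completion) (auto simp: borel_compact)
      moreover have "K \<in> sets lebesgue" using lmeasurable_compact[OF K] by (rule fmeasurableD)
      ultimately show "integrable (lebesgue_on K) (\<lambda>x. L x - ?c * f x)"
        by (simp add: integrable_restrict_space)
    qed
    from AE_0_if_orthogonal_test_functions[OF open_UNIV this orth]
    have "AE x in lebesgue. L x - ?c * f x = 0" by (simp add: AE_restrict_space_iff)
    then have "AE x in lborel. L x - ?c * f x = 0" by (simp add: AE_completion_iff)
    then show "AE x in lborel. L x / ?c = f x"
      by eventually_elim (use c in \<open>simp add: field_simps\<close>)
  next
    fix x y :: "real^'n" assume d: "norm (x - y) \<le> 1 / 2"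
    show "\<bar>L x / ?c - L y / ?c\<bar> \<le> log_lipschitz_const TYPE('n) B C * norm (x - y) * ln (inverse (norm (x - y)))"
    proof (cases "x = y")
      case False
      define \<delta> where "\<delta> = norm (x - y)"
      have \<delta>: "0 < \<delta>" "\<delta> \<le> 1 / 2" using False d by (auto simp: \<delta>_def)
      define E where "E = B * (144 * measure lborel (cball (0::real^'n) 2))"
      have E: "E \<ge> 0" using B_nonneg by (simp add: E_def)
      define l where "l = ln (inverse \<delta>)"
      \<comment> \<open>Here \<delta> <= 1/2 enters: the logarithm is at least ln 2 >= 1/2, so terms
        linear in \<delta> are absorbed into \<delta> * l.\<close>
      have "ln 2 \<le> l" unfolding l_def using \<delta> by (subst ln_le_cancel_iff) (auto simp: field_simps)
      moreover have "1 / 2 \<le> ln (2::real)" using ln_add_one_self_le_self2 ln2_ge_two_thirds by simp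
      ultimately have l: "1 \<le> 2 * l" by linarith
      \<comment> \<open>The radius is chosen equal to the distance \<delta>, so that replacing
        \<open>L\<close> by \<open>m \<delta>\<close> costs only a multiple of \<delta>.\<close>
      have "\<bar>L x - L y\<bar> \<le> \<bar>m \<delta> x - m \<delta> y\<bar> + 2 * (C * \<delta>)"
        using L[of \<delta> x] L[of \<delta> y] \<delta> by linarith
      also have "\<bar>m \<delta> x - m \<delta> y\<bar> \<le> E * \<delta> + C * 2 ^ CARD('n) * \<delta> * l"
        using m_difference_log[OF False] m_1_difference[of x y] d by (simp add: \<delta>_def l_def E_def)
      finally have "\<bar>L x - L y\<bar> \<le> (2 * C + E) * \<delta> * 1 + C * 2 ^ CARD('n) * \<delta> * l"
        by (simp add: algebra_simps)
      also have "(2 * C + E) * \<delta> * 1 \<le> (2 * C + E) * \<delta> * (2 * l)"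
        using E C_nonneg \<delta> l by (intro mult_left_mono) auto
      finally have "\<bar>L x - L y\<bar> \<le> ((2 * C + E) * 2 + C * 2 ^ CARD('n)) * \<delta> * l"
        by (simp add: algebra_simps)
      then have "\<bar>L x - L y\<bar> / ?c \<le> ((2 * C + E) * 2 + C * 2 ^ CARD('n)) * \<delta> * l / ?c"
        using c by (intro divide_right_mono) auto
      moreover have "\<bar>L x / ?c - L y / ?c\<bar> = \<bar>L x - L y\<bar> / ?c"
        using c by (simp add: diff_divide_distrib[symmetric])
      ultimately show ?thesis by (simp add: log_lipschitz_const_def E_def \<delta>_def l_def)
    qed simp
  qed
qed

end

section \<open>Balls as Lipschitz domains\<close>

text \<open>The height of a hemisphere is steep near the equator. Truncating the argument at R/2
  keeps both roots at least R/2; then |p - q| (p + q) = |a - b| (a + b), with p + q >= R >= a + b,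
  yields constant 1.\<close>

lemma lipschitz_spherical_cap:
  fixes s t R :: real
  assumes "R > 0" "s \<ge> 0" "t \<ge> 0"
  shows "\<bar>sqrt (R\<^sup>2 - (min s (R / 2))\<^sup>2) - sqrt (R\<^sup>2 - (min t (R / 2))\<^sup>2)\<bar> \<le> \<bar>s - t\<bar>"
proof -
  let ?a = "min s (R / 2)" and ?b = "min t (R / 2)"
  have ge: "R / 2 \<le> sqrt (R\<^sup>2 - (min x (R / 2))\<^sup>2)" "(min x (R / 2))\<^sup>2 \<le> R\<^sup>2" if "x \<ge> 0" for x
  proof -
    have m: "(min x (R / 2))\<^sup>2 \<le> (R / 2)\<^sup>2" using that assms by (intro power_mono) auto
    moreover have "(R / 2)\<^sup>2 \<le> R\<^sup>2" using assms by (intro power_mono) auto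
    ultimately show "(min x (R / 2))\<^sup>2 \<le> R\<^sup>2" by linarith
    have "(R / 2)\<^sup>2 \<le> R\<^sup>2 - (R / 2)\<^sup>2" using assms by (simp add: power_divide)
    then show "R / 2 \<le> sqrt (R\<^sup>2 - (min x (R / 2))\<^sup>2)" using m by (intro real_le_rsqrt) linarith
  qed
  let ?p = "sqrt (R\<^sup>2 - ?a\<^sup>2)" and ?q = "sqrt (R\<^sup>2 - ?b\<^sup>2)"
  have "R * \<bar>?p - ?q\<bar> \<le> \<bar>?p + ?q\<bar> * \<bar>?p - ?q\<bar>"
    using ge(1)[OF assms(2)] ge(1)[OF assms(3)] by (intro mult_right_mono) auto
  also have "\<dots> = \<bar>?p\<^sup>2 - ?q\<^sup>2\<bar>" by (simp add: abs_mult[symmetric] power2_eq_square algebra_simps)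
  also have "\<dots> = \<bar>?a\<^sup>2 - ?b\<^sup>2\<bar>"
    using ge(2)[OF assms(2)] ge(2)[OF assms(3)] by simp
  also have "\<dots> = \<bar>?a + ?b\<bar> * \<bar>?a - ?b\<bar>" by (simp add: abs_mult[symmetric] power2_eq_square algebra_simps)
  also have "\<dots> \<le> R * \<bar>s - t\<bar>" using assms by (intro mult_mono) auto
  finally show ?thesis using assms(1) by simp
qed

text \<open>Near a boundary point \<open>p\<close> the ball lies above the lower hemisphere seen in
  the inward normal direction. Points within R/2 of \<open>p\<close> have tangential distance below
  R/2 from the axis, where the truncated height is the true one.\<close>

lemma lipschitz_boundary_ball:
  fixes x :: "real^'n::finite"
  assumes "R > 0"
  shows "lipschitz_boundary (ball x R)"
  unfolding lipschitz_boundary_def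
proof
  fix p assume "p \<in> frontier (ball x R)"
  then have p: "norm (p - x) = R" using assms by (simp add: dist_norm norm_minus_commute)
  define e where "e = (1 / R) *\<^sub>R (x - p)"
  have ne: "norm e = 1" using p assms by (simp add: e_def norm_minus_commute)
  then have ee: "e \<bullet> e = 1" by (simp add: norm_eq_1)
  have xp: "x - p = R *\<^sub>R e" using assms by (simp add: e_def)
  define y0 where "y0 = x - (x \<bullet> e) *\<^sub>R e"
  define g where "g y = x \<bullet> e - sqrt (R\<^sup>2 - (min (norm (y - y0)) (R / 2))\<^sup>2)" for y
  have "1-lipschitz_on {y. y \<bullet> e = 0} g"
  proof (rule lipschitz_onI)
    fix y y'
    show "dist (g y) (g y') \<le> 1 * dist y y'"
      using lipschitz_spherical_cap[OF assms norm_ge_zero norm_ge_zero, of "y - y0" "y' - y0"]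
        norm_triangle_ineq3[of "y - y0" "y' - y0"]
      by (simp add: g_def dist_norm)
  qed simp
  moreover have "z \<in> ball x R \<longleftrightarrow> z \<bullet> e > g (z - (z \<bullet> e) *\<^sub>R e)" if z: "z \<in> ball p (R / 2)" for z
  proof -
    define w where "w = z - x"
    define q where "q = w - (w \<bullet> e) *\<^sub>R e"
    have zp: "norm (z - p) < R / 2" using z by (simp add: dist_norm norm_minus_commute)
    have w_eq: "w = (z - p) - R *\<^sub>R e" using xp by (simp add: w_def algebra_simps)
    have we: "w \<bullet> e = (z - p) \<bullet> e - R" by (simp add: w_eq inner_diff_left ee)
    have pyth: "(norm (a - (a \<bullet> e) *\<^sub>R e))\<^sup>2 + (a \<bullet> e)\<^sup>2 = (norm a)\<^sup>2" for a
      unfolding power2_norm_eq_inner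
      by (simp add: inner_diff_left inner_diff_right ee inner_commute power2_eq_square)
    have q_eq: "q = (z - p) - ((z - p) \<bullet> e) *\<^sub>R e" by (simp add: q_def we) (simp add: w_eq algebra_simps)
    have "(norm q)\<^sup>2 \<le> (norm (z - p))\<^sup>2" using pyth[of "z - p"] by (simp add: q_eq flip: pyth[of "z - p"])
    then have q_le: "norm q < R / 2" using zp power2_le_imp_le[of "norm q" "norm (z - p)"] by simp
    have "(z - (z \<bullet> e) *\<^sub>R e) - y0 = q" by (simp add: q_def w_def y0_def algebra_simps)
    then have g_eq: "g (z - (z \<bullet> e) *\<^sub>R e) = x \<bullet> e - sqrt (R\<^sup>2 - (norm q)\<^sup>2)"
      using q_le by (simp add: g_def min_def)
    \<comment> \<open>The point lies below the centre in direction \<open>e\<close>, so comparing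
      squares below is the same as comparing the positive height with the root.\<close>
    have neg: "- (w \<bullet> e) > 0"
      using norm_cauchy_schwarz[of "z - p" e] zp ne we assms by simp
    have "z \<in> ball x R \<longleftrightarrow> (norm w)\<^sup>2 < R\<^sup>2"
      using assms power_strict_mono[of "norm w" R 2] power2_less_imp_less[of "norm w" R]
      by (auto simp: w_def dist_norm norm_minus_commute)
    also have "\<dots> \<longleftrightarrow> (- (w \<bullet> e))\<^sup>2 < R\<^sup>2 - (norm q)\<^sup>2" using pyth[of w] by (auto simp: q_def)
    also have "\<dots> \<longleftrightarrow> - (w \<bullet> e) < sqrt (R\<^sup>2 - (norm q)\<^sup>2)"
      using neg by (metis real_less_rsqrt real_sqrt_less_iff real_sqrt_abs abs_of_pos)
    also have "\<dots> \<longleftrightarrow> z \<bullet> e > g (z - (z \<bullet> e) *\<^sub>R e)" by (auto simp: g_eq w_def inner_diff_left)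
    finally show ?thesis .
  qed
  then have "ball x R \<inter> ball p (R / 2) = {z \<in> ball p (R / 2). z \<bullet> e > g (z - (z \<bullet> e) *\<^sub>R e)}" by blast
  ultimately show "\<exists>r>0. \<exists>e g L. norm e = 1 \<and> L-lipschitz_on {y. y \<bullet> e = 0} g \<and>
      ball x R \<inter> ball p r = {x \<in> ball p r. x \<bullet> e > g (x - (x \<bullet> e) *\<^sub>R e)}"
    using ne assms by (intro exI[of _ "R / 2"] conjI exI[of _ e] exI[of _ g] exI[of _ 1]) auto
qed

section \<open>Weak gradients on open sets: uniqueness, sums and integration by parts\<close>

lemma L1_loc_component:
  fixes G :: "real^'n::finite \<Rightarrow> real^'k::finite^'m::finite"
  assumes "G \<in> L1_loc \<Omega>"
  shows "(\<lambda>x. G x $ i $ j) \<in> L1_loc \<Omega>"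
  using assms unfolding L1_loc_def
  by (auto intro!: integrable_bounded_linear[OF bounded_linear_compose[OF bounded_linear_vec_nth bounded_linear_vec_nth]])

lemma L1_loc_nth:
  fixes f :: "real^'n::finite \<Rightarrow> real^'m::finite"
  assumes "f \<in> L1_loc \<Omega>"
  shows "(\<lambda>x. f x $ i) \<in> L1_loc \<Omega>"
  using assms unfolding L1_loc_def by (auto intro!: integrable_bounded_linear[OF bounded_linear_vec_nth])

lemma L1_loc_add: "f \<in> L1_loc \<Omega> \<Longrightarrow> g \<in> L1_loc \<Omega> \<Longrightarrow> (\<lambda>x. f x + g x) \<in> L1_loc \<Omega>"
  unfolding L1_loc_def by auto

lemma L1_loc_diff: "f \<in> L1_loc \<Omega> \<Longrightarrow> g \<in> L1_loc \<Omega> \<Longrightarrow> (\<lambda>x. f x - g x) \<in> L1_loc \<Omega>"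
  unfolding L1_loc_def by auto

lemma continuous_L1_loc:
  fixes f :: "real^'n::finite \<Rightarrow> 'b::euclidean_space"
  assumes "continuous_on UNIV f"
  shows "f \<in> L1_loc \<Omega>"
  unfolding L1_loc_def
proof safe
  fix K :: "(real^'n) set" assume K: "compact K"
  have "integrable lborel (\<lambda>x. indicator K x *\<^sub>R f x)"
    using K assms by (intro borel_integrable_compact) (auto intro: continuous_on_subset)
  moreover have "(\<lambda>x. indicator K x *\<^sub>R f x) \<in> borel_measurable lborel"
    using borel_measurable_continuous_onI[OF assms] K
    by (intro borel_measurable_scaleR borel_measurable_indicator) (auto simp: borel_compact)
  ultimately have "integrable lebesgue (\<lambda>x. indicator K x *\<^sub>R f x)" by (simp add: integrable_completion)
  moreover have "K \<in> sets lebesgue" using lmeasurable_compact[OF K] by (rule fmeasurableD)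
  ultimately show "integrable (lebesgue_on K) f" by (simp add: integrable_restrict_space)
qed

lemma integrable_L1_loc_mult:
  fixes h :: "real^'n::finite \<Rightarrow> real"
  assumes h: "h \<in> L1_loc \<Omega>" and Om: "open \<Omega>" and cont: "continuous_on UNIV \<psi>"
    and K: "compact K" "K \<subseteq> \<Omega>" "\<And>x. x \<notin> K \<Longrightarrow> \<psi> x = 0"
  shows "integrable (lebesgue_on \<Omega>) (\<lambda>x. h x * \<psi> x)"
proof -
  obtain S where S: "S > 0" "\<And>x. \<bar>\<psi> x\<bar> \<le> S"
    using continuous_compact_support_bounded[OF cont K(1,3)] by metis
  have i: "integrable lebesgue (\<lambda>x. indicator K x * h x)" by (rule L1_locD[OF h K(1,2)])
  have "integrable lebesgue (\<lambda>x. (indicator K x * h x) * \<psi> x)"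
  proof (rule Bochner_Integration.integrable_bound[where f = "\<lambda>x. S * (indicator K x * h x)"])
    show "(\<lambda>x. (indicator K x * h x) * \<psi> x) \<in> borel_measurable lebesgue"
      using borel_measurable_continuous_onI[OF cont]
      by (intro borel_measurable_times[OF borel_measurable_integrable[OF i]]) (simp add: measurable_completion)
    show "AE x in lebesgue. norm ((indicator K x * h x) * \<psi> x) \<le> norm (S * (indicator K x * h x))"
    proof (rule AE_I2)
      fix x
      have "\<bar>indicator K x * h x\<bar> * \<bar>\<psi> x\<bar> \<le> \<bar>indicator K x * h x\<bar> * \<bar>S\<bar>"
        using S by (intro mult_left_mono) (auto intro: order.trans[OF _ abs_ge_self])
      then show "norm ((indicator K x * h x) * \<psi> x) \<le> norm (S * (indicator K x * h x))"
        by (simp only: real_norm_def abs_mult mult.commute)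
    qed
  qed (use i in auto)
  also have "(\<lambda>x. (indicator K x * h x) * \<psi> x) = (\<lambda>x. indicator \<Omega> x *\<^sub>R (h x * \<psi> x))"
    using K(2,3) by (auto simp: fun_eq_iff split: split_indicator)
  finally show ?thesis using Om by (simp add: integrable_restrict_space)
qed

lemma test_function_integrable:
  fixes h :: "real^'n::finite \<Rightarrow> real"
  assumes "h \<in> L1_loc \<Omega>" "open \<Omega>" "\<phi> \<in> test_functions \<Omega>"
  shows "integrable (lebesgue_on \<Omega>) (\<lambda>x. h x * \<phi> x)" "integrable (lebesgue_on \<Omega>) (\<lambda>x. h x * partial j \<phi> x)"
proof -
  obtain K where K: "compact K" "K \<subseteq> \<Omega>" "\<And>x. x \<notin> K \<Longrightarrow> \<phi> x = 0" and c: "continuous_on UNIV \<phi>" "continuous_on UNIV (partial j \<phi>)"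
    using test_functionsD[OF assms(3)] by metis
  show "integrable (lebesgue_on \<Omega>) (\<lambda>x. h x * \<phi> x)"
    by (rule integrable_L1_loc_mult[OF assms(1,2) c(1) K])
  show "integrable (lebesgue_on \<Omega>) (\<lambda>x. h x * partial j \<phi> x)"
    using partial_eq_0_outside[OF compact_imp_closed[OF K(1)] K(3)]
    by (intro integrable_L1_loc_mult[OF assms(1,2) c(2) K(1,2)]) auto
qed

lemma weak_gradient_unique:
  fixes f :: "real^'n::finite \<Rightarrow> real^'m::finite"
  assumes Om: "open \<Omega>" and G: "is_weak_gradient \<Omega> f G" and H: "is_weak_gradient \<Omega> f H"
  shows "AE x in lebesgue_on \<Omega>. G x = H x"
proof -
  have L: "(\<lambda>x. G x $ i $ j) \<in> L1_loc \<Omega>" "(\<lambda>x. H x $ i $ j) \<in> L1_loc \<Omega>" for i j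
    using G H by (auto simp: is_weak_gradient_def intro: L1_loc_component)
  have "AE x in lebesgue_on \<Omega>. G x $ i $ j - H x $ i $ j = 0" for i j
  proof (rule AE_0_if_orthogonal_test_functions[OF Om L1_loc_diff[OF L]])
    fix \<phi> assume \<phi>: "\<phi> \<in> test_functions \<Omega>"
    then show "(LINT x|lebesgue_on \<Omega>. (G x $ i $ j - H x $ i $ j) * \<phi> x) = 0"
      using G H test_function_integrable(1)[OF L(1) Om \<phi>] test_function_integrable(1)[OF L(2) Om \<phi>]
      by (simp add: left_diff_distrib is_weak_gradient_def)
  qed
  then have "AE x in lebesgue_on \<Omega>. \<forall>i j. G x $ i $ j - H x $ i $ j = 0"
    by (intro eventually_all_finite)
  then show ?thesis by eventually_elim (simp add: vec_eq_iff)
qed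

text \<open>The chosen gradient is a weak gradient as soon as one exists, so uniqueness applies.
  This lets any explicit weak gradient be used inside energies and norms.\<close>

lemma weak_gradient_AE_eq:
  assumes "open \<Omega>" "is_weak_gradient \<Omega> f G"
  shows "AE x in lebesgue_on \<Omega>. weak_gradient \<Omega> f x = G x"
proof (rule weak_gradient_unique[OF assms(1) _ assms(2)])
  show "is_weak_gradient \<Omega> f (weak_gradient \<Omega> f)"
    unfolding weak_gradient_def using assms(2) by (rule someI[of "is_weak_gradient \<Omega> f"])
qed

lemma is_weak_gradient_add:
  fixes f :: "real^'n::finite \<Rightarrow> real^'m::finite"
  assumes Om: "open \<Omega>" and f: "is_weak_gradient \<Omega> f F" and g: "is_weak_gradient \<Omega> g G"
  shows "is_weak_gradient \<Omega> (\<lambda>x. f x + g x) (\<lambda>x. F x + G x)"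
  unfolding is_weak_gradient_def
proof (intro conjI ballI allI)
  show "(\<lambda>x. f x + g x) \<in> L1_loc \<Omega>" "(\<lambda>x. F x + G x) \<in> L1_loc \<Omega>"
    using f g by (auto simp: is_weak_gradient_def intro!: L1_loc_add)
  fix \<phi> i j assume \<phi>: "\<phi> \<in> test_functions \<Omega>"
  have L: "(\<lambda>x. f x $ i) \<in> L1_loc \<Omega>" "(\<lambda>x. g x $ i) \<in> L1_loc \<Omega>"
    "(\<lambda>x. F x $ i $ j) \<in> L1_loc \<Omega>" "(\<lambda>x. G x $ i $ j) \<in> L1_loc \<Omega>"
    using f g by (auto simp: is_weak_gradient_def intro: L1_loc_component L1_loc_nth)
  show "(LINT x|lebesgue_on \<Omega>. (f x + g x) $ i * partial j \<phi> x) =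
      - (LINT x|lebesgue_on \<Omega>. (F x + G x) $ i $ j * \<phi> x)"
    using f g \<phi> test_function_integrable[OF L(1) Om \<phi>] test_function_integrable[OF L(2) Om \<phi>]
      test_function_integrable[OF L(3) Om \<phi>] test_function_integrable[OF L(4) Om \<phi>]
    by (simp add: distrib_right is_weak_gradient_def)
qed

text \<open>The product of \<open>w\<close> and \<phi> has compact support, so its partial
  derivative integrates to 0 over the whole space; the integrand vanishes outside \<open>K\<close>,
  hence the same holds over \<Omega>.\<close>

lemma integration_by_parts:
  fixes w :: "real^'n::finite \<Rightarrow> real"
  assumes Om: "open \<Omega>" and w: "w \<in> smooth_alg" and K: "compact K" "K \<subseteq> \<Omega>" "\<And>x. x \<notin> K \<Longrightarrow> w x = 0"
    and \<phi>: "\<phi> \<in> test_functions \<Omega>"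
  shows "(LINT x|lebesgue_on \<Omega>. w x * partial j \<phi> x) = - (LINT x|lebesgue_on \<Omega>. partial j w x * \<phi> x)"
proof -
  have c: "continuous_on UNIV \<phi>" "continuous_on UNIV (partial j \<phi>)" "\<phi> differentiable (at x)" for x
    using test_functionsD[OF \<phi>] by metis+
  have cw: "continuous_on UNIV w" "continuous_on UNIV (partial j w)"
    by (intro smooth_alg_continuous smooth_algD(2) w)+
  have p: "partial j (\<lambda>x. w x * \<phi> x) = (\<lambda>x. w x * partial j \<phi> x + partial j w x * \<phi> x)"
    using partial_mult[OF smooth_algD(1)[OF w] c(3)] by blast
  have "(LINT x|lborel. partial j (\<lambda>x. w x * \<phi> x) x) = 0"
  proof (rule integral_partial_eq_0[OF _ _ K(1)])
    show "(\<lambda>x. w x * \<phi> x) differentiable (at x)" for x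
      by (intro differentiable_mult smooth_algD(1)[OF w] c(3))
    show "continuous_on UNIV (partial j (\<lambda>x. w x * \<phi> x))"
      unfolding p by (intro continuous_intros cw c)
  qed (use K in auto)
  then have int0: "(LINT x|lebesgue. w x * partial j \<phi> x + partial j w x * \<phi> x) = 0"
    unfolding p by (subst integral_completion)
      (auto intro!: borel_measurable_continuous_onI continuous_intros cw c)
  have "indicator \<Omega> x *\<^sub>R (w x * partial j \<phi> x + partial j w x * \<phi> x) =
      w x * partial j \<phi> x + partial j w x * \<phi> x" for x
    using K partial_eq_0_outside[where f = w and x = x and j = j, OF compact_imp_closed[OF K(1)] K(3)] by (cases "x \<in> K") auto
  then have "(\<lambda>x. indicator \<Omega> x *\<^sub>R (w x * partial j \<phi> x + partial j w x * \<phi> x)) =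
      (\<lambda>x. w x * partial j \<phi> x + partial j w x * \<phi> x)" by (rule ext)
  moreover have "\<Omega> \<inter> space lebesgue \<in> sets lebesgue" using Om by simp
  ultimately have "(LINT x|lebesgue_on \<Omega>. w x * partial j \<phi> x + partial j w x * \<phi> x) = 0"
    by (simp only: integral_restrict_space int0)
  then show ?thesis
    using test_function_integrable(2)[OF continuous_L1_loc[OF cw(1)] Om \<phi>]
      test_function_integrable(1)[OF continuous_L1_loc[OF cw(2)] Om \<phi>] by simp
qed

section \<open>Minimizers\<close>

lemma borel_measurable_lebesgue_on:
  "f \<in> borel_measurable borel \<Longrightarrow> f \<in> borel_measurable (lebesgue_on S)"
  by (intro measurable_restrict_space1 measurable_completion) simp

lemma AE_lebesgue_on:
  assumes "open \<Omega>" "AE x in lebesgue. P x"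
  shows "AE x in lebesgue_on \<Omega>. P x"
  using assms by (simp add: AE_restrict_space_iff) (auto elim: eventually_mono)

lemma continuous_on_axis:
  assumes "continuous_on S f"
  shows "continuous_on S (\<lambda>x. axis i (f x))"
  unfolding axis_def
proof (rule continuous_on_vec_lambda)
  show "continuous_on S (\<lambda>x. if k = i then f x else 0)" for k by (cases "k = i") (use assms in auto)
qed

lemma norm_axis_eq: "norm (axis i x) = norm x" for x :: "'b::real_inner"
  unfolding norm_eq_sqrt_inner inner_axis_axis by simp

lemma continuous_compact_support_L2:
  fixes f :: "real^'n::finite \<Rightarrow> 'b::euclidean_space"
  assumes cont: "continuous_on UNIV f" and Om: "open \<Omega>"
    and K: "compact K" "K \<subseteq> \<Omega>" "\<And>x. x \<notin> K \<Longrightarrow> f x = 0"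
  shows "f \<in> L2 \<Omega>"
proof -
  have "integrable (lebesgue_on \<Omega>) (\<lambda>x. 1 * (norm (f x))\<^sup>2)"
    using K cont by (intro integrable_L1_loc_mult[OF continuous_L1_loc Om _ K(1,2)] continuous_intros) auto
  then show ?thesis
    using borel_measurable_lebesgue_on[OF borel_measurable_continuous_onI[OF cont]] by (simp add: L2_def)
qed

definition gradient :: "(real^'n::finite \<Rightarrow> real) \<Rightarrow> real^'n \<Rightarrow> real^'n" where
  "gradient w x = (\<chi> j. partial j w x)"

lemma is_weak_gradient_axis:
  fixes w :: "real^'n::finite \<Rightarrow> real" and i :: "'m::finite"
  assumes Om: "open \<Omega>" and w: "w \<in> smooth_alg" and K: "compact K" "K \<subseteq> \<Omega>" "\<And>x. x \<notin> K \<Longrightarrow> w x = 0"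
  shows "is_weak_gradient \<Omega> (\<lambda>x. axis i (w x)) (\<lambda>x. axis i (gradient w x))"
  unfolding is_weak_gradient_def
proof (intro conjI ballI allI)
  show "(\<lambda>x. axis i (w x)) \<in> L1_loc \<Omega>"
    by (intro continuous_L1_loc continuous_on_axis smooth_alg_continuous w)
  show "(\<lambda>x. axis i (gradient w x)) \<in> L1_loc \<Omega>"
    unfolding gradient_def
    by (intro continuous_L1_loc continuous_on_axis continuous_on_vec_lambda smooth_alg_continuous smooth_algD(2) w)
  fix \<phi> k j assume "\<phi> \<in> test_functions \<Omega>"
  from integration_by_parts[OF Om w K this]
  show "(LINT x|lebesgue_on \<Omega>. axis i (w x) $ k * partial j \<phi> x) =
      - (LINT x|lebesgue_on \<Omega>. axis i (gradient w x) $ k $ j * \<phi> x)"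
    by (cases "k = i") (auto simp: axis_def gradient_def)
qed

lemma gradient_eq_0:
  assumes "compact K" "\<And>x. x \<notin> K \<Longrightarrow> w x = 0" "x \<notin> K"
  shows "gradient w x = 0"
  using partial_eq_0_outside[where f = w, OF compact_imp_closed[OF assms(1)] assms(2,3)]
  by (simp add: gradient_def vec_eq_iff)

lemma gradient_continuous: "w \<in> smooth_alg \<Longrightarrow> continuous_on S (gradient w)"
  unfolding gradient_def[abs_def] by (intro continuous_on_vec_lambda smooth_alg_continuous smooth_algD(2))

text \<open>The function is smooth with compact support already, so the constant sequence
  approximates it.\<close>

lemma axis_W12_0:
  fixes w :: "real^'n::finite \<Rightarrow> real" and i :: "'m::finite"
  assumes Om: "open \<Omega>" and w: "w \<in> smooth_alg" and K: "compact K" "K \<subseteq> \<Omega>" "\<And>x. x \<notin> K \<Longrightarrow> w x = 0"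
  shows "(\<lambda>x. axis i (w x)) \<in> W12_0 \<Omega>"
proof -
  have "(\<lambda>x. axis i (w x)) \<in> L2 \<Omega>"
    by (intro continuous_compact_support_L2[OF _ Om K(1,2)] continuous_on_axis smooth_alg_continuous w)
      (simp add: K(3) axis_eq_0_iff)
  moreover have "(\<lambda>x. axis i (gradient w x)) \<in> L2 \<Omega>"
    by (intro continuous_compact_support_L2[OF _ Om K(1,2)] continuous_on_axis gradient_continuous w)
      (simp add: gradient_eq_0[where w = w, OF K(1,3)] axis_eq_0_iff)
  ultimately have 1: "(\<lambda>x. axis i (w x)) \<in> W12 \<Omega>"
    using is_weak_gradient_axis[OF Om w K, of i] by (auto simp: W12_def)
  have "(\<lambda>x. axis i (w x) $ k) \<in> test_functions \<Omega>" for k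
  proof (cases "k = i")
    case True
    then show ?thesis using smooth_alg_test_function[OF w K] by (simp add: axis_def)
  next
    case False
    then show ?thesis using smooth_alg_test_function[OF smooth_alg.const[of 0] K(1,2)] by (simp add: axis_def)
  qed
  moreover have "W12_norm \<Omega> (\<lambda>x. axis i (w x) - axis i (w x)) = 0"
  proof -
    \<comment> \<open>Even the gradient chosen for the zero function is known only almost
      everywhere, so its norm is computed through uniqueness.\<close>
    have "is_weak_gradient \<Omega> (\<lambda>x. 0 :: real^'m) (\<lambda>x. 0)"
      by (auto simp: is_weak_gradient_def intro: continuous_L1_loc)
    from weak_gradient_AE_eq[OF Om this]
    have "(LINT x|lebesgue_on \<Omega>. (norm (weak_gradient \<Omega> (\<lambda>x. 0 :: real^'m) x))\<^sup>2) = 0"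
      by (intro integral_eq_zero_AE) (auto elim: eventually_mono)
    then show ?thesis by (simp add: W12_norm_def)
  qed
  ultimately show ?thesis
    using 1 unfolding W12_0_def by (intro CollectI conjI exI[of _ "\<lambda>_ x. axis i (w x)"]) auto
qed

lemma laplacian_eq_0:
  assumes "closed K" "\<And>x. x \<notin> K \<Longrightarrow> w x = 0" "x \<notin> K"
  shows "laplacian w x = 0"
  using partial_eq_0_outside[OF assms(1) partial_eq_0_outside[where f = w, OF assms(1,2)] assms(3)]
  by (simp add: laplacian_def)

text \<open>Each \<open>partial j w\<close> is a test function, so the definition of the weak
  gradient is applied once per direction j and summed. No second derivative of \<open>u\<close> is
  involved.\<close>

lemma integral_weak_gradient_laplacian:
  fixes u :: "real^'n::finite \<Rightarrow> real^'m::finite"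
  assumes Om: "open \<Omega>" and w: "w \<in> smooth_alg" and K: "compact K" "K \<subseteq> \<Omega>" "\<And>x. x \<notin> K \<Longrightarrow> w x = 0"
    and G: "is_weak_gradient \<Omega> u G"
  shows "(LINT x|lebesgue. u x $ i * laplacian w x) = - (LINT x|lebesgue_on \<Omega>. inner (G x) (axis i (gradient w x)))"
proof -
  have Om': "\<Omega> \<inter> space lebesgue \<in> sets lebesgue" using Om by simp
  have tf: "partial j w \<in> test_functions \<Omega>" for j
    using partial_eq_0_outside[where f = w, OF compact_imp_closed[OF K(1)] K(3)]
    by (intro smooth_alg_test_function[OF smooth_algD(2)[OF w] K(1,2)]) auto
  have L: "(\<lambda>x. u x $ i) \<in> L1_loc \<Omega>" "(\<lambda>x. G x $ i $ j) \<in> L1_loc \<Omega>" for j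
    using G by (auto simp: is_weak_gradient_def intro: L1_loc_component L1_loc_nth)
  have eq: "(\<lambda>x. u x $ i * laplacian w x) = (\<lambda>x. indicator \<Omega> x *\<^sub>R (u x $ i * laplacian w x))"
    using laplacian_eq_0[where w = w, OF compact_imp_closed[OF K(1)] K(3)] K(2)
    by (auto simp: fun_eq_iff split: split_indicator)
  have "(LINT x|lebesgue. u x $ i * laplacian w x) = (LINT x|lebesgue_on \<Omega>. u x $ i * laplacian w x)"
    by (subst eq) (simp only: integral_restrict_space[OF Om'])
  also have "\<dots> = (\<Sum>j\<in>UNIV. LINT x|lebesgue_on \<Omega>. u x $ i * partial j (partial j w) x)"
    unfolding laplacian_def sum_distrib_left
    by (intro Bochner_Integration.integral_sum test_function_integrable(2)[OF L(1) Om tf])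
  also have "\<dots> = (\<Sum>j\<in>UNIV. - (LINT x|lebesgue_on \<Omega>. G x $ i $ j * partial j w x))"
    using G tf by (intro sum.cong) (auto simp: is_weak_gradient_def)
  also have "\<dots> = - (LINT x|lebesgue_on \<Omega>. (\<Sum>j\<in>UNIV. G x $ i $ j * partial j w x))"
    unfolding sum_negf
    by (subst Bochner_Integration.integral_sum) (auto intro: test_function_integrable(1)[OF L(2) Om tf])
  also have "(\<lambda>x. \<Sum>j\<in>UNIV. G x $ i $ j * partial j w x) = (\<lambda>x. inner (G x) (axis i (gradient w x)))"
    unfolding inner_axis by (simp add: inner_vec_def gradient_def)
  finally show ?thesis .
qed

lemma energy_AE_eq:
  fixes u :: "real^'n::finite \<Rightarrow> real^'m::finite"
  assumes "open \<Omega>" "is_weak_gradient \<Omega> u G"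
  shows "energy W \<Omega> u = (\<integral>\<^sup>+x. ennreal ((norm (G x))\<^sup>2 / 2 + W (u x)) \<partial>lebesgue_on \<Omega>)"
  unfolding energy_def using weak_gradient_AE_eq[OF assms]
  by (intro nn_integral_cong_AE) (auto elim: eventually_mono)

text \<open>One side of the weak Laplacian bound. The competitor changes only component i;
  \<open>S\<close> bounds W at u + v because |u + v| <= M + b, and |grad w|^2 <= n b^2.\<close>

lemma minimizer_integral_laplacian_le:
  fixes u :: "real^'n::finite \<Rightarrow> real^'m::finite"
  assumes min: "minimizer W u" and M: "AE x in lebesgue. norm (u x) < M"
    and W [measurable]: "W \<in> borel_measurable borel" and W_nonneg: "\<And>z. W z \<ge> 0"
    and S: "\<And>z. norm z \<le> M + b \<Longrightarrow> W z \<le> S"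
    and R: "R > 0" and w: "w \<in> smooth_alg" and K: "\<And>z. z \<notin> cball x R \<Longrightarrow> w z = 0"
    and b: "\<And>z. \<bar>w z\<bar> \<le> b" "\<And>z j. \<bar>partial j w z\<bar> \<le> b"
  shows "(LINT z|lebesgue. u z $ i * laplacian w z)
    \<le> (real CARD('n) * b\<^sup>2 / 2 + S) * measure lebesgue (ball x (2 * R))"
proof -
  \<comment> \<open>The domain has twice the radius so that the closed ball supporting
    \<open>w\<close> is a compact subset of an open set.\<close>
  define \<Omega> where "\<Omega> = ball x (2 * R)"
  let ?L = "lebesgue_on \<Omega>"
  have Om: "open \<Omega>" by (simp add: \<Omega>_def)
  have sub: "cball x R \<subseteq> \<Omega>" using R by (auto simp: \<Omega>_def)
  have b0: "b \<ge> 0" using b(1)[of 0] by linarith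
  define v :: "real^'n \<Rightarrow> real^'m" where "v = (\<lambda>x. axis i (w x))"
  define D :: "real^'n \<Rightarrow> real^'n^'m" where "D = (\<lambda>x. axis i (gradient w x))"
  have "u \<in> W12 \<Omega>" using min by (simp add: minimizer_def W12_loc_def \<Omega>_def compact_cball)
  then obtain G where uL2: "u \<in> L2 \<Omega>" and G: "is_weak_gradient \<Omega> u G" and GL2: "G \<in> L2 \<Omega>"
    by (auto simp: W12_def)
  have D: "is_weak_gradient \<Omega> v D"
    unfolding v_def D_def by (rule is_weak_gradient_axis[OF Om w compact_cball sub K])
  have [measurable]: "u \<in> borel_measurable ?L" "G \<in> borel_measurable ?L"
    using uL2 GL2 by (auto simp: L2_def)
  have [measurable]: "v \<in> borel_measurable ?L" "D \<in> borel_measurable ?L"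
    unfolding v_def D_def
    by (intro borel_measurable_lebesgue_on borel_measurable_continuous_onI continuous_on_axis
        gradient_continuous smooth_alg_continuous w)+
  have DL2: "D \<in> L2 \<Omega>"
    unfolding D_def
    by (intro continuous_compact_support_L2[OF _ Om compact_cball sub] continuous_on_axis gradient_continuous w)
      (simp only: gradient_eq_0[where w = w, OF compact_cball K] axis_eq_0_iff not_False_eq_True)
  have v_le: "norm (v z) \<le> b" for z using b(1) by (simp add: v_def norm_axis_eq)
  have D_le: "(norm (D z))\<^sup>2 \<le> real CARD('n) * b\<^sup>2" for z
  proof -
    have "(norm (D z))\<^sup>2 = (\<Sum>j\<in>UNIV. (partial j w z)\<^sup>2)"
      unfolding D_def norm_axis_eq power2_norm_eq_inner by (simp add: gradient_def inner_vec_def power2_eq_square)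
    also have "\<dots> \<le> (\<Sum>j\<in>(UNIV::'n set). b\<^sup>2)"
      using b(2) b0 by (intro sum_mono) (metis abs_le_square_iff abs_of_nonneg)
    finally show ?thesis by simp
  qed
  have fin: "emeasure ?L (space ?L) < \<infinity>"
    using emeasure_bounded_finite[OF bounded_ball, of x "2 * R"] Om
    by (simp add: emeasure_restrict_space \<Omega>_def)
  have uM: "AE z in ?L. norm (u z) < M" by (rule AE_lebesgue_on[OF Om M])
  have "AE z in ?L. W (u z) \<le> S \<and> W (u z + v z) \<le> S"
    using uM
  proof eventually_elim
    case (elim z)
    then have "norm (u z + v z) \<le> M + b" using norm_triangle_ineq[of "u z" "v z"] v_le[of z] by linarith
    then show ?case using S elim b0 by simp
  qed
  then have Wu: "AE z in ?L. W (u z) \<le> S" "AE z in ?L. W (u z + v z) \<le> S" by auto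
  interpret finite_measure ?L by (rule finite_measureI) (use fin in auto)
  have iW: "integrable ?L (\<lambda>z. W (u z))" "integrable ?L (\<lambda>z. W (u z + v z))"
    by (rule integrable_const_bound[where B = S], use Wu W_nonneg in simp, measurable)+
  have iG: "integrable ?L (\<lambda>z. (norm (G z))\<^sup>2)" and iD: "integrable ?L (\<lambda>z. (norm (D z))\<^sup>2)"
    using GL2 DL2 by (auto simp: L2_def)
  have iGD: "integrable ?L (\<lambda>z. inner (G z) (D z))"
  proof (rule Bochner_Integration.integrable_bound)
    show "integrable ?L (\<lambda>z. (norm (G z))\<^sup>2 + (norm (D z))\<^sup>2)" using iG iD by simp
    have "\<bar>inner (G z) (D z)\<bar> \<le> (norm (G z))\<^sup>2 + (norm (D z))\<^sup>2" for z
      using Cauchy_Schwarz_ineq2[of "G z" "D z"] sum_squares_bound[of "norm (G z)" "norm (D z)"]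
        mult_nonneg_nonneg[OF norm_ge_zero[of "G z"] norm_ge_zero[of "D z"]] by linarith
    then show "AE z in ?L. norm (inner (G z) (D z)) \<le> norm ((norm (G z))\<^sup>2 + (norm (D z))\<^sup>2)" by simp
  qed measurable
  have sq: "(norm (G z + D z))\<^sup>2 / 2 + W (u z + v z) =
      (norm (G z))\<^sup>2 / 2 + (inner (G z) (D z) + (norm (D z))\<^sup>2 / 2 + W (u z + v z))" for z
    by (simp add: power2_norm_eq_inner inner_add_left inner_add_right inner_commute field_simps)
  have i1: "integrable ?L (\<lambda>z. (norm (G z))\<^sup>2 / 2 + W (u z))" using iG iW by simp
  have i2: "integrable ?L (\<lambda>z. (norm (G z + D z))\<^sup>2 / 2 + W (u z + v z))"
    unfolding sq using iG iD iGD iW by simp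
  have "bounded \<Omega>" "lipschitz_boundary \<Omega>" using R by (auto simp: \<Omega>_def intro: lipschitz_boundary_ball)
  moreover have "v \<in> W12_0 \<Omega>" unfolding v_def by (rule axis_W12_0[OF Om w compact_cball sub K])
  moreover have "v \<in> Linf \<Omega>" using v_le by (auto simp: Linf_def)
  ultimately have "energy W \<Omega> u \<le> energy W \<Omega> (\<lambda>z. u z + v z)"
    using min Om by (simp add: minimizer_def)
  then have "(\<integral>\<^sup>+z. ennreal ((norm (G z))\<^sup>2 / 2 + W (u z)) \<partial>?L)
      \<le> (\<integral>\<^sup>+z. ennreal ((norm (G z + D z))\<^sup>2 / 2 + W (u z + v z)) \<partial>?L)"
    by (simp add: energy_AE_eq[OF Om G] energy_AE_eq[OF Om is_weak_gradient_add[OF Om G D]])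
  moreover have "(\<integral>\<^sup>+z. ennreal ((norm (G z))\<^sup>2 / 2 + W (u z)) \<partial>?L) = ennreal (LINT z|?L. (norm (G z))\<^sup>2 / 2 + W (u z))"
    by (rule nn_integral_eq_integral[OF i1]) (simp add: W_nonneg)
  moreover have "(\<integral>\<^sup>+z. ennreal ((norm (G z + D z))\<^sup>2 / 2 + W (u z + v z)) \<partial>?L) =
      ennreal (LINT z|?L. (norm (G z + D z))\<^sup>2 / 2 + W (u z + v z))"
    by (rule nn_integral_eq_integral[OF i2]) (simp add: W_nonneg)
  moreover have "0 \<le> (LINT z|?L. (norm (G z + D z))\<^sup>2 / 2 + W (u z + v z))"
    by (intro Bochner_Integration.integral_nonneg) (simp add: W_nonneg)
  ultimately have "(LINT z|?L. (norm (G z))\<^sup>2 / 2 + W (u z)) \<le> (LINT z|?L. (norm (G z + D z))\<^sup>2 / 2 + W (u z + v z))"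
    by (simp only: ennreal_le_iff)
  \<comment> \<open>Both energies are finite, so after expanding the square the common term |G|^2 /
    2 cancels.\<close>
  then have "(LINT z|?L. W (u z)) \<le> (LINT z|?L. inner (G z) (D z)) + (LINT z|?L. (norm (D z))\<^sup>2 / 2 + W (u z + v z))"
    unfolding sq using iG iD iGD iW by simp
  moreover have "0 \<le> (LINT z|?L. W (u z))" using W_nonneg by simp
  moreover have "(LINT z|?L. (norm (D z))\<^sup>2 / 2 + W (u z + v z)) \<le> (LINT z|?L. real CARD('n) * b\<^sup>2 / 2 + S)"
  proof (rule integral_mono_AE)
    show "AE z in ?L. (norm (D z))\<^sup>2 / 2 + W (u z + v z) \<le> real CARD('n) * b\<^sup>2 / 2 + S"
      using Wu(2) by eventually_elim (use D_le in \<open>simp add: add_mono divide_right_mono\<close>)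
  qed (use iD iW in auto)
  moreover have "(LINT z|?L. real CARD('n) * b\<^sup>2 / 2 + S) = (real CARD('n) * b\<^sup>2 / 2 + S) * measure lebesgue \<Omega>"
    using Om by (simp add: measure_restrict_space)
  ultimately have "- (LINT z|?L. inner (G z) (D z)) \<le> (real CARD('n) * b\<^sup>2 / 2 + S) * measure lebesgue \<Omega>"
    by linarith
  then show ?thesis
    using integral_weak_gradient_laplacian[OF Om w compact_cball sub K G, of i] by (simp add: D_def \<Omega>_def)
qed

text \<open>The one-sided estimate is applied to \<open>w\<close> and to its negative. The volume of
  the ball of radius 2R contributes the factor 2^n besides R^n.\<close>

lemma minimizer_bounded_weak_laplacian:
  fixes u :: "real^'n::finite \<Rightarrow> real^'m::finite"
  assumes min: "minimizer W u" and M: "AE x in lebesgue. norm (u x) < M"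
    and W: "W \<in> borel_measurable borel" "\<And>z. W z \<ge> 0" and S: "\<And>z. norm z \<le> M + 1000 \<Longrightarrow> W z \<le> S" "S \<ge> 0"
    and B: "B \<ge> 0" "B \<ge> M"
  obtains f where "AE x in lborel. f x = u x $ i"
    "bounded_weak_laplacian f B ((real CARD('n) * 1000\<^sup>2 / 2 + S) * (unit_ball_vol (real CARD('n)) * 2 ^ CARD('n)))"
proof -
  have "u \<in> borel_measurable lebesgue"
    using min by (simp add: minimizer_def Linf_def lebesgue_on_UNIV_eq)
  then have u_i: "(\<lambda>x. u x $ i) \<in> borel_measurable lebesgue"
    unfolding cart_eq_inner_axis by (intro borel_measurable_inner borel_measurable_const)
  then obtain f0 where [measurable]: "f0 \<in> borel_measurable borel" and f0: "AE x in lborel. u x $ i = f0 x"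
    using completion_ex_borel_measurable_real[of "\<lambda>x. u x $ i" lborel] by auto
  \<comment> \<open>The locale asks for a Borel function bounded everywhere, whereas
    \<open>u\<close> is Lebesgue measurable and bounded almost everywhere. Truncating a Borel
    version changes it only on a null set.\<close>
  define f where "f x = max (- B) (min B (f0 x))" for x
  have [measurable]: "f \<in> borel_measurable borel" unfolding f_def[abs_def] by measurable
  have M': "AE x in lborel. norm (u x) < M" using M by (simp add: AE_completion_iff)
  have ae: "AE x in lborel. f x = u x $ i"
    using f0 M'
  proof eventually_elim
    case (elim x)
    then have "\<bar>f0 x\<bar> \<le> B" using component_le_norm_cart[of "u x" i] B by linarith
    then show ?case using elim by (simp add: f_def)
  qed
  let ?C0 = "real CARD('n) * 1000\<^sup>2 / 2 + S"
  have "bounded_weak_laplacian f B (?C0 * (unit_ball_vol (real CARD('n)) * 2 ^ CARD('n)))"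
  proof
    show "\<bar>f z\<bar> \<le> B" for z using B by (auto simp: f_def abs_le_iff)
    show "0 \<le> ?C0 * (unit_ball_vol (real CARD('n)) * 2 ^ CARD('n))" using S by (intro mult_nonneg_nonneg) auto
    fix w :: "real^'n \<Rightarrow> real" and x R
    assume w: "w \<in> smooth_alg" and R: "0 < R" "R \<le> 2" and K: "\<And>z. z \<notin> cball x R \<Longrightarrow> w z = 0"
      and b: "\<And>z. \<bar>w z\<bar> \<le> 1000" "\<And>z j. \<bar>partial j w z\<bar> \<le> 1000"
    have vol: "measure lebesgue (ball x (2 * R)) = unit_ball_vol (real CARD('n)) * 2 ^ CARD('n) * R ^ CARD('n)"
      using R by (simp add: content_ball power_mult_distrib)
    have 1: "(LINT z|lebesgue. u z $ i * laplacian w z) \<le> ?C0 * measure lebesgue (ball x (2 * R))"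
      by (rule minimizer_integral_laplacian_le[OF min M W S(1) R(1) w K b])
    have "(LINT z|lebesgue. u z $ i * laplacian (\<lambda>z. -1 * w z) z) \<le> ?C0 * measure lebesgue (ball x (2 * R))"
    proof (rule minimizer_integral_laplacian_le[OF min M W S(1) R(1)])
      show "(\<lambda>z. -1 * w z) \<in> smooth_alg" by (intro smooth_alg.mult smooth_alg.const w)
      show "\<bar>partial j (\<lambda>z. -1 * w z) z\<bar> \<le> 1000" for z j
        using b(2) unfolding partial_cmult[OF smooth_algD(1)[OF w]] by simp
    qed (use K b in auto)
    then have 2: "- (LINT z|lebesgue. u z $ i * laplacian w z) \<le> ?C0 * measure lebesgue (ball x (2 * R))"
      unfolding laplacian_cmult[OF w] by simp
    have [measurable]: "laplacian w \<in> borel_measurable borel"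
      by (intro borel_measurable_continuous_onI continuous_laplacian w)
    have "(LINT z|lborel. f z * laplacian w z) = (LINT z|lebesgue. f z * laplacian w z)"
      by (rule integral_completion[symmetric]) measurable
    also have "\<dots> = (LINT z|lebesgue. u z $ i * laplacian w z)"
    proof (rule integral_cong_AE)
      show "(\<lambda>z. u z $ i * laplacian w z) \<in> borel_measurable lebesgue"
        by (rule borel_measurable_times[OF u_i]) (simp add: measurable_completion)
      show "AE z in lebesgue. f z * laplacian w z = u z $ i * laplacian w z"
        using AE_completion[OF ae] by eventually_elim simp
    qed (simp add: measurable_completion)
    finally show "\<bar>LINT z|lborel. f z * laplacian w z\<bar>
        \<le> ?C0 * (unit_ball_vol (real CARD('n)) * 2 ^ CARD('n)) * R ^ CARD('n)"
      using 1 2 by (simp add: vol mult.assoc abs_le_iff)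
  qed simp
  then show ?thesis using ae that by blast
qed

section \<open>Bounds for the potential, Hoelder continuity and the final assembly\<close>

lemma potential_measurable_nonneg_locally_bounded:
  fixes A :: "(real^'m::finite) set" and W :: "real^'m \<Rightarrow> real"
  assumes "finite A" and "0 \<le> \<alpha>"
    and H1: "0 < \<alpha> \<Longrightarrow> H1 \<alpha> A W"
    and ind: "\<alpha> = 0 \<Longrightarrow> W = indicator (- A)"
  shows "W \<in> borel_measurable borel" "\<And>z. W z \<ge> 0" "\<exists>S\<ge>0. \<forall>z. norm z \<le> r \<longrightarrow> W z \<le> S"
proof -
  have "W \<in> borel_measurable borel \<and> (\<forall>z. W z \<ge> 0) \<and> (\<exists>S\<ge>0. \<forall>z. norm z \<le> r \<longrightarrow> W z \<le> S)"
  proof (cases "\<alpha> = 0")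
    case True
    have "A \<in> sets borel" using assms(1) by (intro borel_closed finite_imp_closed)
    then show ?thesis using ind[OF True] by (auto intro!: exI[of _ 1] split: split_indicator)
  next
    case False
    then have "H1 \<alpha> A W" using H1 assms(2) by simp
    then have W: "continuous_on UNIV W" "\<And>z. W z \<ge> 0" by (auto simp: H1_def)
    have "bounded (W ` cball 0 r)"
      using W(1) by (intro compact_imp_bounded compact_continuous_image) (auto intro: continuous_on_subset)
    then obtain S where "S > 0" "\<And>z. z \<in> cball 0 r \<Longrightarrow> norm (W z) \<le> S" by (auto simp: bounded_pos)
    then have "\<exists>S\<ge>0. \<forall>z. norm z \<le> r \<longrightarrow> W z \<le> S" using W(2) by (intro exI[of _ S]) auto
    then show ?thesis using W borel_measurable_continuous_onI by blast
  qed
  then show "W \<in> borel_measurable borel" "\<And>z. W z \<ge> 0" "\<exists>S\<ge>0. \<forall>z. norm z \<le> r \<longrightarrow> W z \<le> S" by auto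
qed

text \<open>At distance \<delta> <= 1/2 the logarithm is beaten by a power, ln s <= s^(1-\<beta>) /
  (1-\<beta>) with s = 1/\<delta>. At larger distances the bound 2b suffices because
  (2\<delta>)^\<beta> >= 1. The constant adds the two cases.\<close>

lemma log_lipschitz_imp_holder:
  fixes v :: "real^'n::finite \<Rightarrow> real^'m::finite"
  assumes bd: "\<And>x. norm (v x) \<le> b" and C: "C \<ge> 0"
    and log: "\<And>x y. norm (x - y) \<le> 1 / 2 \<Longrightarrow> norm (v x - v y) \<le> C * norm (x - y) * ln (inverse (norm (x - y)))"
    and \<beta>: "0 < \<beta>" "\<beta> < 1"
  shows "v \<in> holder_space \<beta>"
  unfolding holder_space_def
proof (intro CollectI conjI exI allI)
  show "bounded (range v)" using bd by (auto simp: bounded_iff)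
  have b: "b \<ge> 0" using bd[of 0] norm_ge_zero[of "v 0"] by linarith
  fix x y :: "real^'n"
  let ?K = "C / (1 - \<beta>) + 2 * b * 2 powr \<beta>"
  show "norm (v x - v y) \<le> ?K * norm (x - y) powr \<beta>"
  proof (cases "x = y")
    case False
    define \<delta> where "\<delta> = norm (x - y)"
    have \<delta>: "\<delta> > 0" using False by (simp add: \<delta>_def)
    have nn: "0 \<le> C / (1 - \<beta>)" "0 \<le> 2 * b * 2 powr \<beta>" using C \<beta> b by auto
    show ?thesis
    proof (cases "\<delta> \<le> 1 / 2")
      case True
      have "(1 - \<beta>) * ln (inverse \<delta>) = ln (inverse \<delta> powr (1 - \<beta>))" using \<delta> by (simp add: ln_powr)
      also have "\<dots> \<le> inverse \<delta> powr (1 - \<beta>)"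
        using \<delta> by (intro ln_bound) auto
      finally have l: "ln (inverse \<delta>) \<le> inverse \<delta> powr (1 - \<beta>) / (1 - \<beta>)" using \<beta> by (simp add: field_simps)
      have "norm (v x - v y) \<le> C * \<delta> * ln (inverse \<delta>)" using log True by (simp add: \<delta>_def)
      also have "\<dots> \<le> C * \<delta> * (inverse \<delta> powr (1 - \<beta>) / (1 - \<beta>))"
        using C \<delta> l by (intro mult_left_mono) auto
      also have "\<dots> = C / (1 - \<beta>) * (\<delta> powr 1 * \<delta> powr (\<beta> - 1))"
        using \<delta> by (simp add: inverse_powr powr_minus[symmetric])
      also have "\<dots> = C / (1 - \<beta>) * \<delta> powr \<beta>" using \<delta> by (subst powr_add[symmetric]) simp
      also have "\<dots> \<le> ?K * \<delta> powr \<beta>" using nn by (intro mult_right_mono) auto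
      finally show ?thesis by (simp add: \<delta>_def)
    next
      case False
      have "1 \<le> (2 * \<delta>) powr \<beta>" using False \<beta> by (intro ge_one_powr_ge_zero) auto
      then have 1: "1 \<le> 2 powr \<beta> * \<delta> powr \<beta>" using \<delta> by (simp add: powr_mult)
      have "norm (v x - v y) \<le> 2 * b" using norm_triangle_ineq4[of "v x" "v y"] bd[of x] bd[of y] by linarith
      also have "\<dots> \<le> 2 * b * (2 powr \<beta> * \<delta> powr \<beta>)" using b 1 by (simp add: mult_le_cancel_left1)
      also have "\<dots> \<le> ?K * \<delta> powr \<beta>"
        using mult_right_mono[of "2 * b * 2 powr \<beta>" ?K "\<delta> powr \<beta>"] nn by (simp only: mult.assoc) simp
      finally show ?thesis by (simp add: \<delta>_def)
    qed
  qed simp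
qed

lemma log_lipschitz_const_nonneg: "B \<ge> 0 \<Longrightarrow> C \<ge> 0 \<Longrightarrow> log_lipschitz_const TYPE('n::finite) B C \<ge> 0"
  using mollifier_mass_pos[where 'n = 'n] by (simp add: log_lipschitz_const_def)

text \<open>The constant is fixed before \<open>u\<close>, so it is uniform over all minimizers with
  the bound M. As \<open>u\<close> matters only up to null sets, the estimate concerns a
  representative; at x = y its right-hand side is 0 through the factor
  \<open>norm (x - y)\<close>.\<close>

theorem lemma2p1:
  fixes A :: "(real^'m::finite) set" and W :: "real^'m \<Rightarrow> real" and \<alpha> M :: real
  assumes "finite A" and "card A \<ge> 2"
    and "0 \<le> \<alpha>" and "\<alpha> < 2"
    and "0 < \<alpha> \<Longrightarrow> H1 \<alpha> A W"
    and "\<alpha> = 0 \<Longrightarrow> W = indicator (- A)"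
  shows "\<exists>C::real. \<forall>u :: real^'n::finite \<Rightarrow> real^'m.
    minimizer W u \<and> (AE x in lebesgue. norm (u x) < M) \<longrightarrow>
    (\<exists>v. (AE x in lebesgue. v x = u x) \<and>
       (\<forall>x y. norm (x - y) \<le> 1/2 \<longrightarrow>
          norm (v x - v y) \<le> C * norm (x - y) * ln (inverse (norm (x - y)))) \<and>
       (\<forall>\<beta>. 0 < \<beta> \<and> \<beta> < 1 \<longrightarrow> v \<in> holder_space \<beta>))"
proof -
  note W = potential_measurable_nonneg_locally_bounded[OF assms(1,3,5,6)]
  obtain S where S: "S \<ge> 0" "\<And>z. norm z \<le> M + 1000 \<Longrightarrow> W z \<le> S"
    using W(3)[of "M + 1000"] by auto
  \<comment> \<open>The absolute value keeps the bound nonnegative for every real M.\<close>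
  define B where "B = \<bar>M\<bar>"
  have B: "B \<ge> 0" "B \<ge> M" by (auto simp: B_def)
  define C0 where "C0 = (real CARD('n) * 1000\<^sup>2 / 2 + S) * (unit_ball_vol (real CARD('n)) * 2 ^ CARD('n))"
  have C0: "C0 \<ge> 0" unfolding C0_def using S(1) by (intro mult_nonneg_nonneg) auto
  define C1 where "C1 = log_lipschitz_const TYPE('n) B C0"
  have C1: "C1 \<ge> 0" unfolding C1_def by (rule log_lipschitz_const_nonneg[OF B(1) C0])
  \<comment> \<open>The factor is the number of components, since the norm of a vector is estimated
    by the sum of the absolute values of its entries.\<close>
  define C where "C = real CARD('m) * C1"
  show ?thesis
  proof (intro exI[of _ C] allI impI, elim conjE)
    fix u :: "real^'n \<Rightarrow> real^'m"
    assume min: "minimizer W u" and M: "AE x in lebesgue. norm (u x) < M"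
    have "\<exists>g. (AE x in lborel. g x = u x $ i) \<and> (\<forall>x. \<bar>g x\<bar> \<le> B) \<and>
        (\<forall>x y. norm (x - y) \<le> 1 / 2 \<longrightarrow> \<bar>g x - g y\<bar> \<le> C1 * norm (x - y) * ln (inverse (norm (x - y))))" for i
    proof -
      obtain f where f: "AE x in lborel. f x = u x $ i" "bounded_weak_laplacian f B C0"
        using minimizer_bounded_weak_laplacian[OF min M W(1,2) S(2,1) B, of i] unfolding C0_def by blast
      interpret bounded_weak_laplacian f B C0 by (rule f(2))
      obtain g where g: "AE x in lborel. g x = f x" "\<And>x. \<bar>g x\<bar> \<le> B"
        "\<And>x y. norm (x - y) \<le> 1 / 2 \<Longrightarrow> \<bar>g x - g y\<bar> \<le> C1 * norm (x - y) * ln (inverse (norm (x - y)))"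
        unfolding C1_def by (rule log_lipschitz_representative) blast
      have "AE x in lborel. g x = u x $ i" using g(1) f(1) by eventually_elim simp
      then show ?thesis using g by blast
    qed
    then have "\<forall>i. \<exists>g. (AE x in lborel. g x = u x $ i) \<and> (\<forall>x. \<bar>g x\<bar> \<le> B) \<and>
        (\<forall>x y. norm (x - y) \<le> 1 / 2 \<longrightarrow> \<bar>g x - g y\<bar> \<le> C1 * norm (x - y) * ln (inverse (norm (x - y))))"
      by (rule allI)
    from choice[OF this] obtain g where g: "\<And>i. AE x in lborel. g i x = u x $ i" "\<And>i x. \<bar>g i x\<bar> \<le> B"
      "\<And>i x y. norm (x - y) \<le> 1 / 2 \<Longrightarrow> \<bar>g i x - g i y\<bar> \<le> C1 * norm (x - y) * ln (inverse (norm (x - y)))"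
      by blast
    define v :: "real^'n \<Rightarrow> real^'m" where "v x = (\<chi> i. g i x)" for x
    have "AE x in lborel. \<forall>i. g i x = u x $ i" using g(1) by (intro eventually_all_finite)
    then have ae: "AE x in lebesgue. v x = u x"
      by (intro AE_completion) (auto elim!: eventually_mono simp: v_def vec_eq_iff)
    have log: "norm (v x - v y) \<le> C * norm (x - y) * ln (inverse (norm (x - y)))" if "norm (x - y) \<le> 1 / 2" for x y
    proof -
      have "norm (v x - v y) \<le> (\<Sum>i\<in>UNIV. \<bar>g i x - g i y\<bar>)"
        using norm_le_l1_cart[of "v x - v y"] by (simp add: v_def)
      also have "\<dots> \<le> (\<Sum>i\<in>(UNIV::'m set). C1 * norm (x - y) * ln (inverse (norm (x - y))))"
        by (intro sum_mono g(3) that)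
      finally show ?thesis by (simp add: C_def mult.assoc)
    qed
    have bd: "norm (v x) \<le> real CARD('m) * B" for x
    proof -
      have "norm (v x) \<le> (\<Sum>i\<in>UNIV. \<bar>g i x\<bar>)" using norm_le_l1_cart[of "v x"] by (simp add: v_def)
      also have "\<dots> \<le> (\<Sum>i\<in>(UNIV::'m set). B)" by (intro sum_mono g(2))
      finally show ?thesis by simp
    qed
    have "C \<ge> 0" using C1 by (simp add: C_def)
    from log_lipschitz_imp_holder[OF bd this log]
    have "v \<in> holder_space \<beta>" if "0 < \<beta>" "\<beta> < 1" for \<beta> using that by blast
    with ae log show "\<exists>v. (AE x in lebesgue. v x = u x) \<and>
       (\<forall>x y. norm (x - y) \<le> 1/2 \<longrightarrow>
          norm (v x - v y) \<le> C * norm (x - y) * ln (inverse (norm (x - y)))) \<and>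
       (\<forall>\<beta>. 0 < \<beta> \<and> \<beta> < 1 \<longrightarrow> v \<in> holder_space \<beta>)" by blast
  qed
qed

end
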